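(* For any $d\geq 1$, there exists $\beta_1(d)\in(0,\beta_c(d)]$ such that for any $\beta\in[0,\beta_1(d))$, as $n\rightarrow\infty$, $X_n/\sqrt{\mathbb{E}_{\Lambda_n,\beta}(X_n^2)}$ converges in distribution to a random variable with density $$x\mapsto \frac{C\exp(-C^4x^4)}{\int_{-\infty}^{\infty}\exp(-t^4)\,dt},\qquad\text{where } C:=\sqrt{\Gamma(3/4)/\Gamma(1/4)}$$ and $\Gamma$ denotes the gamma function.
   Context: Let $\Lambda_n:=[-n,n]^d\cap\mathbb{Z}^d$. The Ising model on $\Lambda_n$ at inverse temperature $\beta\geq0$ with free boundary conditions (zero external field) is the probability measure on $\{-1,+1\}^{\Lambda_n}$ giving $\sigma$ probability proportional to $\exp[\beta\sum_{\{u,v\}}\sigma_u\sigma_v]$, the sum being over nearest-neighbor edges $\{u,v\}$ with $u,v\in\Lambda_n$; $\langle\cdot\rangle_{\Lambda_n,\beta}$ denotes its expectation. $\beta_c(d)$ is the critical inverse temperature of the nearest-neighbor Ising model on $\mathbb{Z}^d$ (with $\beta_c(1)=\infty$). $Y_n(\sigma):=\sum_{u\in\Lambda_n}\sigma_u$ is the total magnetization, with distribution function $F_{Y_n}$ under this measure. $X_n$ is a random variable whose distribution function $F_{X_n}$ satisfies $$\frac{dF_{X_n}}{dF_{Y_n}}(x)=\frac{\exp[x^2/(2\langle Y_n^2\rangle_{\Lambda_n,\beta})]}{\langle\exp[Y_n^2/(2\langle Y_n^2\rangle_{\Lambda_n,\beta})]\rangle_{\Lambda_n,\beta}};$$ equivalently,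 $X_n$ is the total magnetization of the perturbed model in which $\sigma\in\{-1,+1\}^{\Lambda_n}$ has probability proportional to $\exp[\beta\sum_{\{u,v\}}\sigma_u\sigma_v+Y_n^2(\sigma)/(2\langle Y_n^2\rangle_{\Lambda_n,\beta})]$. $\mathbb{E}_{\Lambda_n,\beta}$ denotes expectation for this perturbed model. *)

theory Defs
  imports "HOL-Probability.Probability"
begin

text \<open>
  A point of \<open>\<int>\<^sup>d\<close> is an extensional function on \<open>{..<d}\<close>, and a spin configuration on a finite
  \<open>\<Lambda> \<subseteq> \<int>\<^sup>d\<close> is an extensional function on \<open>\<Lambda>\<close> with values in \<open>{-1, 1}\<close>.
\<close>

definition lattice_box :: "nat \<Rightarrow> nat \<Rightarrow> (nat \<Rightarrow> int) set" where
  "lattice_box d n = {..<d} \<rightarrow>\<^sub>E {- int n..int n}"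

definition nearest_neighbor :: "nat \<Rightarrow> (nat \<Rightarrow> int) \<Rightarrow> (nat \<Rightarrow> int) \<Rightarrow> bool" where
  "nearest_neighbor d u v \<longleftrightarrow> (\<Sum>i<d. \<bar>u i - v i\<bar>) = 1"

definition edges :: "nat \<Rightarrow> (nat \<Rightarrow> int) set \<Rightarrow> (nat \<Rightarrow> int) set set" where
  "edges d \<Lambda> = {{u, v} |u v. u \<in> \<Lambda> \<and> v \<in> \<Lambda> \<and> nearest_neighbor d u v}"

definition spin_configs :: "'v set \<Rightarrow> ('v \<Rightarrow> real) set" where
  "spin_configs \<Lambda> = \<Lambda> \<rightarrow>\<^sub>E {-1, 1}"

text \<open>
  The probability measure on spin configurations with weights proportional to \<open>exp (h \<sigma>)\<close>; there is
  no minus sign and no separate temperature.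
\<close>

definition gibbs_measure :: "'v set \<Rightarrow> (('v \<Rightarrow> real) \<Rightarrow> real) \<Rightarrow> ('v \<Rightarrow> real) measure" where
  "gibbs_measure \<Lambda> h =
     point_measure (spin_configs \<Lambda>)
       (\<lambda>\<sigma>. ennreal (exp (h \<sigma>) / (\<Sum>\<tau>\<in>spin_configs \<Lambda>. exp (h \<tau>))))"

text \<open>An edge has two distinct end points, so \<open>\<Prod>u\<in>e. \<sigma> u\<close> is the product of its two spins.\<close>

definition interaction :: "nat \<Rightarrow> nat \<Rightarrow> ((nat \<Rightarrow> int) \<Rightarrow> real) \<Rightarrow> real" where
  "interaction d n \<sigma> = (\<Sum>e\<in>edges d (lattice_box d n). \<Prod>u\<in>e. \<sigma> u)"

definition ising_free :: "nat \<Rightarrow> nat \<Rightarrow> real \<Rightarrow> ((nat \<Rightarrow> int) \<Rightarrow> real) measure" where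
  "ising_free d n \<beta> = gibbs_measure (lattice_box d n) (\<lambda>\<sigma>. \<beta> * interaction d n \<sigma>)"

text \<open>
  Plus boundary condition: all spins outside the box are \<open>+1\<close>. Every neighbor of a point of
  \<open>lattice_box d n\<close> lies in \<open>lattice_box d (n + 1)\<close>, so the double sum runs over all edges of
  \<open>\<int>\<^sup>d\<close> leaving the box.
\<close>

definition ising_plus :: "nat \<Rightarrow> nat \<Rightarrow> real \<Rightarrow> ((nat \<Rightarrow> int) \<Rightarrow> real) measure" where
  "ising_plus d n \<beta> = gibbs_measure (lattice_box d n)
     (\<lambda>\<sigma>. \<beta> * (interaction d n \<sigma> +
        (\<Sum>u\<in>lattice_box d n.
           \<Sum>v\<in>{v \<in> lattice_box d (n + 1) - lattice_box d n. nearest_neighbor d u v}. \<sigma> u)))"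

definition spontaneous_magnetization :: "nat \<Rightarrow> real \<Rightarrow> real" where
  "spontaneous_magnetization d \<beta> =
     lim (\<lambda>n. LINT \<sigma>|ising_plus d n \<beta>. \<sigma> (\<lambda>i\<in>{..<d}. 0))"

text \<open>The infimum is taken in the extended reals, so it is \<open>\<infinity>\<close> if there is no phase transition.\<close>

definition beta_c :: "nat \<Rightarrow> ereal" where
  "beta_c d = (INF \<beta>\<in>{\<beta>. 0 \<le> \<beta> \<and> spontaneous_magnetization d \<beta> > 0}. ereal \<beta>)"

definition magnetization :: "nat \<Rightarrow> nat \<Rightarrow> ((nat \<Rightarrow> int) \<Rightarrow> real) \<Rightarrow> real" where
  "magnetization d n \<sigma> = (\<Sum>u\<in>lattice_box d n. \<sigma> u)"

definition Y_moment2 :: "nat \<Rightarrow> nat \<Rightarrow> real \<Rightarrow> real" where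
  "Y_moment2 d n \<beta> = (LINT \<sigma>|ising_free d n \<beta>. (magnetization d n \<sigma>)\<^sup>2)"

definition Y_law :: "nat \<Rightarrow> nat \<Rightarrow> real \<Rightarrow> real measure" where
  "Y_law d n \<beta> = distr (ising_free d n \<beta>) borel (magnetization d n)"

definition X_law :: "nat \<Rightarrow> nat \<Rightarrow> real \<Rightarrow> real measure" where
  "X_law d n \<beta> = density (Y_law d n \<beta>)
     (\<lambda>x. ennreal (exp (x\<^sup>2 / (2 * Y_moment2 d n \<beta>)) /
        (LINT \<sigma>|ising_free d n \<beta>. exp ((magnetization d n \<sigma>)\<^sup>2 / (2 * Y_moment2 d n \<beta>)))))"

definition perturbed_ising :: "nat \<Rightarrow> nat \<Rightarrow> real \<Rightarrow> ((nat \<Rightarrow> int) \<Rightarrow> real) measure" where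
  "perturbed_ising d n \<beta> = gibbs_measure (lattice_box d n)
     (\<lambda>\<sigma>. \<beta> * interaction d n \<sigma> + (magnetization d n \<sigma>)\<^sup>2 / (2 * Y_moment2 d n \<beta>))"

lemma finite_lattice_box: "finite (lattice_box d n)"
  by (simp add: lattice_box_def finite_PiE)

lemma finite_spin_configs: "finite \<Lambda> \<Longrightarrow> finite (spin_configs \<Lambda>)"
  by (simp add: spin_configs_def finite_PiE)

lemma spin_configs_nonempty: "spin_configs \<Lambda> \<noteq> {}"
  by (simp add: spin_configs_def PiE_eq_empty_iff)

lemma partition_function_pos:
  assumes "finite \<Lambda>"
  shows "(\<Sum>\<tau>\<in>spin_configs \<Lambda>. exp (h \<tau> :: real)) > 0"
  by (intro sum_pos finite_spin_configs spin_configs_nonempty assms) simp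

lemma prob_space_gibbs_measure:
  assumes "finite \<Lambda>"
  shows "prob_space (gibbs_measure \<Lambda> h)"
  unfolding gibbs_measure_def
proof (rule prob_space_point_measure)
  show "finite (spin_configs \<Lambda>)"
    by (rule finite_spin_configs[OF assms])
  show "(\<Sum>\<sigma>\<in>spin_configs \<Lambda>. ennreal (exp (h \<sigma>) / (\<Sum>\<tau>\<in>spin_configs \<Lambda>. exp (h \<tau>)))) = 1"
    using partition_function_pos[OF assms, of h]
    by (subst sum_ennreal) (auto simp: sum_nonneg simp flip: sum_divide_distrib)
qed simp

lemma integral_gibbs_measure:
  fixes f :: "('v \<Rightarrow> real) \<Rightarrow> real"
  assumes "finite \<Lambda>"
  shows "(LINT \<sigma>|gibbs_measure \<Lambda> h. f \<sigma>) =
    (\<Sum>\<sigma>\<in>spin_configs \<Lambda>. exp (h \<sigma>) * f \<sigma>) / (\<Sum>\<tau>\<in>spin_configs \<Lambda>. exp (h \<tau>))"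
  unfolding gibbs_measure_def
  using partition_function_pos[OF assms, of h] finite_spin_configs[OF assms]
  by (subst lebesgue_integral_point_measure_finite) (auto simp: sum_divide_distrib sum_nonneg)

lemma density_gibbs_measure:
  assumes "finite \<Lambda>"
  shows "density (gibbs_measure \<Lambda> h)
      (\<lambda>\<sigma>. ennreal (exp (g \<sigma>) / (LINT \<sigma>|gibbs_measure \<Lambda> h. exp (g \<sigma>)))) =
    gibbs_measure \<Lambda> (\<lambda>\<sigma>. h \<sigma> + g \<sigma>)"
proof -
  let ?Z = "\<Sum>\<tau>\<in>spin_configs \<Lambda>. exp (h \<tau>)" and ?W = "\<Sum>\<tau>\<in>spin_configs \<Lambda>. exp (h \<tau> + g \<tau>)"
  have pos: "?Z > 0" "?W > 0"
    using partition_function_pos[OF assms] by auto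
  have E: "(LINT \<sigma>|gibbs_measure \<Lambda> h. exp (g \<sigma>)) = ?W / ?Z"
    by (simp add: integral_gibbs_measure[OF assms] exp_add)
  have "ennreal (exp (h \<sigma>) / ?Z) * ennreal (exp (g \<sigma>) / (?W / ?Z)) =
      ennreal (exp (h \<sigma> + g \<sigma>) / ?W)" for \<sigma>
    using pos by (subst ennreal_mult[symmetric]) (auto simp: exp_add)
  then show ?thesis
    unfolding E
    unfolding gibbs_measure_def point_measure_def
    by (subst density_density_eq) auto
qed

lemma X_law_eq_perturbed:
  "X_law d n \<beta> = distr (perturbed_ising d n \<beta>) borel (magnetization d n)"
proof -
  have m: "magnetization d n \<in> borel_measurable (ising_free d n \<beta>)"
    by (simp add: ising_free_def gibbs_measure_def point_measure_def)
  show ?thesis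
    unfolding X_law_def Y_law_def perturbed_ising_def
    by (subst density_distr[OF _ m])
      (simp_all add: density_gibbs_measure finite_lattice_box ising_free_def)
qed

end

theory Submission
  imports Defs "HOL-Complex_Analysis.Cauchy_Integral_Formula"
begin

text \<open>
  At high temperature the model is a small perturbation of independent spins, for which the mean spin
  in a uniform field \<open>h\<close> is \<open>tanh h\<close>. The proof makes this precise for \<^emph>\<open>complex\<close> fields, uniformly in the
  volume, and then lets complex analysis do the rest.
  
  The ratio of the two partition functions in which the spin at a site \<open>v\<close> is fixed to be \<open>+1\<close> or \<open>-1\<close> is
  \<open>exp (2 * h v)\<close> times a ratio of partition functions on the remaining sites with the fields \<open>h + J v\<close> and
  \<open>h - J v\<close>. Changing these fields site by site turns the latter into a product of Moebius functions of
  ratios of the same kind in smaller systems, each close to 1 as long as the smaller ratios have nonnegative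
  real part. By induction on the number of sites there are no zeros for \<open>\<bar>Im h\<bar> \<le> 1 / 2\<close>
  (\<open>partition_function_nonzero\<close>) and the mean spin differs from \<open>tanh (h v)\<close> by a multiple of the
  coupling strength (\<open>spin_mean_near_tanh\<close>). The same recursion is a contraction when two fields that agree
  near \<open>v\<close> are compared (\<open>cavity_ratio_decay\<close>); so the influence of a plus boundary condition on the centre of
  the box decays exponentially, there is no spontaneous magnetization, and \<open>\<beta>\<^sub>1 \<le> \<beta>\<^sub>c\<close>.
  
  Let \<open>N\<close> be the number of sites, \<open>s\<^sup>2 = \<langle>Y\<^sup>2\<rangle>\<close> and \<open>G h = ln \<langle>exp (h Y)\<rangle> - s\<^sup>2 h\<^sup>2 / 2\<close>. Then \<open>G'\<close> is \<open>N\<close> times an odd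
  function that is analytic in a strip with bounds independent of \<open>N\<close> and is close to \<open>tanh h - h\<close>. Cauchy's
  estimates give \<open>G h = - N \<kappa> h\<^sup>4 + O(N h\<^sup>6)\<close> with \<open>\<kappa>\<close> bounded away from 0 and \<open>\<infinity>\<close>, and a bound
  \<open>G h \<le> - c N h\<^sup>4 / (1 + h\<^sup>2)\<close> for all real \<open>h\<close> (\<open>log_laplace_quartic\<close>).
  
  Tilting the law of \<open>Y / s\<close> by \<open>exp (x\<^sup>2 / 2)\<close> and adding an independent standard Gaussian variable produces the
  density \<open>exp (G (u / s))\<close> up to normalization: the quadratic term cancels exactly. In the variable
  \<open>y = (N \<kappa>)\<^bsup>1/4\<^esup> u / s\<close> this density converges to \<open>exp (- y\<^sup>4)\<close>, with a Gaussian majorant, whereas the added Gaussian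
  noise becomes negligible since \<open>s\<close> is of order \<open>N\<^bsup>1/2\<^esup>\<close>. Hence second moments and characteristic functions
  converge (\<open>char_tendsto\<close>), and Levy's continuity theorem gives the claim. The constant \<open>C\<^sup>2\<close> is the variance
  of the density proportional to \<open>exp (- y\<^sup>4)\<close>.
\<close>

section \<open>Spin sums with complex fields\<close>

definition pair_energy :: "('v \<Rightarrow> 'v \<Rightarrow> real) \<Rightarrow> 'v set \<Rightarrow> ('v \<Rightarrow> real) \<Rightarrow> real" where
  "pair_energy J V \<sigma> = (\<Sum>u\<in>V. \<Sum>v\<in>V. J u v * \<sigma> u * \<sigma> v) / 2"

definition weight :: "('v \<Rightarrow> 'v \<Rightarrow> real) \<Rightarrow> 'v set \<Rightarrow> ('v \<Rightarrow> complex) \<Rightarrow> ('v \<Rightarrow> real) \<Rightarrow> complex" where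
  "weight J V h \<sigma> = exp (of_real (pair_energy J V \<sigma>) + (\<Sum>v\<in>V. h v * of_real (\<sigma> v)))"

definition partition_function :: "('v \<Rightarrow> 'v \<Rightarrow> real) \<Rightarrow> 'v set \<Rightarrow> ('v \<Rightarrow> complex) \<Rightarrow> complex" where
  "partition_function J V h = (\<Sum>\<sigma>\<in>spin_configs V. weight J V h \<sigma>)"

text \<open>
  For \<open>v \<notin> V\<close> this is the quotient of the parts of the partition function on \<open>insert v V\<close> with spin \<open>+1\<close> and
  spin \<open>-1\<close> at \<open>v\<close>, if \<open>J\<close> is symmetric without self-coupling: a spin fixed at \<open>v\<close> acts on the other sites as an
  additional field \<open>J v\<close> or \<open>- J v\<close>.
\<close>

definition cavity_ratio :: "('v \<Rightarrow> 'v \<Rightarrow> real) \<Rightarrow> 'v set \<Rightarrow> 'v \<Rightarrow> ('v \<Rightarrow> complex) \<Rightarrow> complex" where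
  "cavity_ratio J V v h = exp (2 * h v) *
     (partition_function J V (\<lambda>u. h u + J v u) / partition_function J V (\<lambda>u. h u - J v u))"

text \<open>
  For \<open>S = V\<close> and \<open>t = J v\<close> this is the second factor of the cavity ratio. General sets \<open>S\<close> allow the shift of
  the field to be made one site at a time.
\<close>

definition shift_ratio :: "('v \<Rightarrow> 'v \<Rightarrow> real) \<Rightarrow> 'v set \<Rightarrow> 'v set \<Rightarrow> ('v \<Rightarrow> real) \<Rightarrow> ('v \<Rightarrow> complex) \<Rightarrow> complex" where
  "shift_ratio J V S t h =
     partition_function J V (\<lambda>u. h u + of_real (if u \<in> S then t u else 0)) /
     partition_function J V (\<lambda>u. h u - of_real (if u \<in> S then t u else 0))"

lemma partition_function_cong:
  assumes "\<And>u. u \<in> V \<Longrightarrow> h u = h' u"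
  shows "partition_function J V h = partition_function J V h'"
proof -
  have "(\<Sum>v\<in>V. h v * of_real (\<sigma> v)) = (\<Sum>v\<in>V. h' v * of_real (\<sigma> v))" for \<sigma> :: "'a \<Rightarrow> real"
    using assms by (intro sum.cong) auto
  then show ?thesis
    by (simp add: partition_function_def weight_def)
qed

lemma partition_function_empty: "partition_function J {} h = 1"
  by (simp add: partition_function_def weight_def spin_configs_def pair_energy_def)

lemma sum_spin_configs_insert:
  fixes g :: "('v \<Rightarrow> real) \<Rightarrow> 'a :: comm_monoid_add"
  assumes "v \<notin> V"
  shows "(\<Sum>\<sigma>\<in>spin_configs (insert v V). g \<sigma>) =
         (\<Sum>\<sigma>\<in>spin_configs V. g (\<sigma>(v := 1))) + (\<Sum>\<sigma>\<in>spin_configs V. g (\<sigma>(v := -1)))"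
proof -
  have inj: "inj_on (\<lambda>(y, g). g(v := y)) ({-1, 1 :: real} \<times> (V \<rightarrow>\<^sub>E {-1, 1}))"
    using assms by (auto intro!: inj_combinator)
  have "(\<Sum>\<sigma>\<in>spin_configs (insert v V). g \<sigma>) =
        (\<Sum>p\<in>{-1, 1 :: real} \<times> spin_configs V. g ((snd p)(v := fst p)))"
    unfolding spin_configs_def PiE_insert_eq
    by (subst sum.reindex[OF inj]) (simp add: case_prod_beta o_def)
  also have "\<dots> = (\<Sum>s\<in>{-1, 1 :: real}. \<Sum>\<sigma>\<in>spin_configs V. g (\<sigma>(v := s)))"
    by (simp add: sum.cartesian_product case_prod_beta)
  finally show ?thesis by (simp add: add.commute)
qed

text \<open>
  This Moebius function describes how the partition function reacts to a change of the field at one site with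
  cavity ratio \<open>R\<close>. With \<open>b = exp (2 * t)\<close> it differs from 1 by \<open>(b - 1) * (R - 1) / (R + b)\<close>, and a point \<open>R\<close> of the
  right half-plane is at least as far from \<open>- b\<close> as from 1.
\<close>

lemma moebius_near_one:
  fixes t :: real
  assumes "Re R \<ge> 0" "t \<ge> 0"
  shows "exp (- of_real t) * R + exp (of_real t) \<noteq> 0"
    and "cmod ((exp (of_real t) * R + exp (- of_real t)) / (exp (- of_real t) * R + exp (of_real t)) - 1)
         \<le> exp (2 * t) - 1"
proof -
  define b where "b = exp (2 * t)"
  have b: "b \<ge> 1" using assms by (simp add: b_def)
  have "Re (R + of_real b) > 0" using assms b by simp
  then have nz: "R + of_real b \<noteq> 0" by fastforce
  have le: "cmod (R - 1) \<le> cmod (R + of_real b)"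
    unfolding cmod_def
    using assms b by (intro real_sqrt_le_mono add_mono iffD1[OF abs_le_square_iff]) (auto simp: abs_if)
  have et: "exp (of_real t) = exp (- of_real t) * complex_of_real b"
    by (simp add: b_def exp_of_real[symmetric] exp_add[symmetric])
  have e1: "exp (- of_real t) * R + exp (of_real t) = exp (- of_real t) * (R + of_real b)"
    by (simp add: et algebra_simps)
  have e2: "exp (of_real t) * R + exp (- of_real t) = exp (- of_real t) * (of_real b * R + 1)"
    by (simp add: et algebra_simps)
  show "exp (- of_real t) * R + exp (of_real t) \<noteq> 0"
    unfolding e1 using nz by simp
  have "(exp (of_real t) * R + exp (- of_real t)) / (exp (- of_real t) * R + exp (of_real t)) - 1
     = of_real (b - 1) * ((R - 1) / (R + of_real b))"
    unfolding e1 e2 mult_divide_mult_cancel_left_if using nz by (simp add: field_simps)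
  then have "cmod ((exp (of_real t) * R + exp (- of_real t)) / (exp (- of_real t) * R + exp (of_real t)) - 1)
     = (b - 1) * (cmod (R - 1) / cmod (R + of_real b))"
    using b by (simp only: norm_mult norm_divide norm_of_real)
  also have "\<dots> \<le> (b - 1) * 1"
    using le nz b by (intro mult_left_mono) (auto simp: divide_le_eq)
  finally show "cmod ((exp (of_real t) * R + exp (- of_real t)) / (exp (- of_real t) * R + exp (of_real t)) - 1)
         \<le> exp (2 * t) - 1" by (simp add: b_def)
qed

text \<open>
  The form \<open>a - 1\<close> of the bounds makes the estimate multiplicative, so that bounds of the form \<open>exp x - 1\<close> add up
  in the exponent.
\<close>

lemma norm_mult_minus_one_le:
  fixes x y :: complex
  assumes "cmod (x - 1) \<le> a - 1" "cmod (y - 1) \<le> b - 1"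
  shows "cmod (x * y - 1) \<le> a * b - 1"
proof -
  have "x * y - 1 = (x - 1) * (y - 1) + (x - 1) + (y - 1)" by (simp add: algebra_simps)
  then have "cmod (x * y - 1) \<le> cmod (x - 1) * cmod (y - 1) + cmod (x - 1) + cmod (y - 1)"
    by (metis norm_mult norm_triangle_ineq norm_triangle_le add_mono_thms_linordered_semiring(3) order_refl)
  also have "\<dots> \<le> (a - 1) * (b - 1) + (a - 1) + (b - 1)"
    using assms order_trans[OF norm_ge_zero assms(1)] by (intro add_mono mult_mono) auto
  finally show ?thesis by (simp add: algebra_simps)
qed

text \<open>
  The Cayley transform takes a cavity ratio to the mean spin. The factor \<open>cmod E\<close> is kept on the left, so that a
  relative error of the cavity ratio becomes an absolute error of the mean spin, however large \<open>E\<close> is.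
\<close>

lemma cayley_diff:
  fixes R E :: complex
  assumes "Re R \<ge> 0" "Re E \<ge> 0"
  shows "cmod ((R - 1) / (R + 1) - (E - 1) / (E + 1)) * cmod E \<le> 2 * cmod (R - E)"
    and "cmod ((R - 1) / (R + 1)) \<le> 1"
proof -
  have pos: "Re (R + 1) > 0" "Re (E + 1) > 0" using assms by auto
  then have nz: "R + 1 \<noteq> 0" "E + 1 \<noteq> 0" by fastforce+
  have R1: "cmod (R + 1) \<ge> 1" using complex_Re_le_cmod[of "R + 1"] assms by simp
  have E1: "cmod (E + 1) \<ge> cmod E"
    unfolding cmod_def using assms by (intro real_sqrt_le_mono) (auto simp: power2_eq_square algebra_simps)
  have "(R - 1) / (R + 1) - (E - 1) / (E + 1) = 2 * ((R - E) / ((R + 1) * (E + 1)))"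
    using nz by (simp add: field_simps)
  then have "cmod ((R - 1) / (R + 1) - (E - 1) / (E + 1)) * cmod E =
     2 * cmod (R - E) * (1 / cmod (R + 1) * (cmod E / cmod (E + 1)))"
    by (simp only: norm_divide norm_mult) simp
  also have "\<dots> \<le> 2 * cmod (R - E) * (1 * 1)"
    using R1 E1 nz by (intro mult_left_mono mult_mono) (auto simp: divide_le_eq)
  finally show "cmod ((R - 1) / (R + 1) - (E - 1) / (E + 1)) * cmod E \<le> 2 * cmod (R - E)" by simp
  have "cmod (R - 1) \<le> cmod (R + 1)"
    unfolding cmod_def using assms by (intro real_sqrt_le_mono) (auto simp: power2_eq_square algebra_simps)
  then show "cmod ((R - 1) / (R + 1)) \<le> 1"
    using nz by (simp add: norm_divide divide_le_eq)
qed

lemma tanh_cayley: "tanh z = (exp (2 * z) - 1) / (exp (2 * z) + (1 :: complex))"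
proof -
  have "exp z - exp (- z) = exp (- z) * (exp (2 * z) - 1)" "exp z + exp (- z) = exp (- z) * (exp (2 * z) + 1)"
    by (simp_all add: algebra_simps exp_add[symmetric])
  then show ?thesis by (simp add: tanh_altdef)
qed

lemma Re_exp_strip:
  assumes "\<bar>Im z\<bar> \<le> 1 / 2"
  shows "Re (exp (2 * z)) \<ge> 0"
  using assms pi_gt3 by (auto simp: Re_exp intro!: mult_nonneg_nonneg cos_ge_zero)

lemma exp_minus_one_le:
  fixes x :: real
  assumes "0 \<le> x" "x \<le> 1"
  shows "exp x - 1 \<le> 2 * x"
  using exp_bound[OF assms] mult_left_mono[OF assms(2,1)] by (simp add: power2_eq_square)

text \<open>
  The inverse temperature is part of the coupling \<open>J\<close>, and \<open>K\<close> bounds the total coupling of a site. The number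
  8000 leaves room in all later estimates.
\<close>

locale ferromagnet =
  fixes J :: "'v \<Rightarrow> 'v \<Rightarrow> real" and K :: real
  assumes sym: "J u v = J v u"
    and no_self: "J v v = 0"
    and nonneg: "0 \<le> J u v"
    and row_sum: "finite V \<Longrightarrow> (\<Sum>u\<in>V. J v u) \<le> K"
    and K_small: "8000 * K \<le> 1"
begin

lemma K_nonneg: "0 \<le> K"
  using row_sum[of "{}"] by simp

abbreviation "Z \<equiv> partition_function J"

lemma pair_energy_insert:
  assumes "finite V" "v \<notin> V"
  shows "pair_energy J (insert v V) (\<sigma>(v := s)) =
         pair_energy J V \<sigma> + s * (\<Sum>u\<in>V. J v u * \<sigma> u)"
proof -
  have upd: "(\<Sum>a\<in>V. c a * (\<sigma>(v := s)) a) = (\<Sum>a\<in>V. c a * \<sigma> a)" for c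
    using assms(2) by (intro sum.cong) auto
  have row: "(\<Sum>a\<in>V. J v a * s * (\<sigma>(v := s)) a) = s * (\<Sum>a\<in>V. J v a * \<sigma> a)"
    unfolding upd by (simp add: sum_distrib_left mult_ac)
  have "(\<Sum>u\<in>V. \<Sum>a\<in>insert v V. J u a * (\<sigma>(v := s)) u * (\<sigma>(v := s)) a)
        = (\<Sum>u\<in>V. J u v * \<sigma> u * s + (\<Sum>a\<in>V. J u a * \<sigma> u * \<sigma> a))"
  proof (intro sum.cong refl)
    fix u assume "u \<in> V"
    then have "(\<sigma>(v := s)) u = \<sigma> u" using assms(2) by auto
    then show "(\<Sum>a\<in>insert v V. J u a * (\<sigma>(v := s)) u * (\<sigma>(v := s)) a) =
      J u v * \<sigma> u * s + (\<Sum>a\<in>V. J u a * \<sigma> u * \<sigma> a)"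
      using assms upd[of "\<lambda>a. J u a * \<sigma> u"] by simp
  qed
  also have "\<dots> = s * (\<Sum>u\<in>V. J v u * \<sigma> u) + (\<Sum>u\<in>V. \<Sum>a\<in>V. J u a * \<sigma> u * \<sigma> a)"
    by (simp add: sum.distrib sum_distrib_left sym[of _ v] mult_ac)
  finally show ?thesis
    using assms row by (simp add: pair_energy_def no_self add_divide_distrib)
qed

lemma weight_insert:
  fixes h :: "'v \<Rightarrow> complex"
  assumes "finite V" "v \<notin> V"
  shows "weight J (insert v V) h (\<sigma>(v := s)) =
         exp (h v * of_real s) * weight J V (\<lambda>u. h u + of_real s * J v u) \<sigma>"
proof -
  have "(\<Sum>u\<in>V. h u * complex_of_real ((\<sigma>(v := s)) u)) = (\<Sum>u\<in>V. h u * complex_of_real (\<sigma> u))"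
    using assms(2) by (intro sum.cong) auto
  then show ?thesis
    using assms
    by (simp add: weight_def pair_energy_insert exp_add[symmetric] algebra_simps sum.distrib
        sum_distrib_left)
qed

lemma partition_function_insert:
  fixes h :: "'v \<Rightarrow> complex"
  assumes "finite V" "v \<notin> V"
  shows "Z (insert v V) h = exp (h v) * Z V (\<lambda>u. h u + J v u) + exp (- h v) * Z V (\<lambda>u. h u - J v u)"
  unfolding partition_function_def sum_spin_configs_insert[OF assms(2)]
  by (simp add: weight_insert[OF assms] sum_distrib_left)

lemma sum_spin_weight_insert:
  fixes h :: "'v \<Rightarrow> complex"
  assumes "finite V" "v \<notin> V"
  shows "(\<Sum>\<sigma>\<in>spin_configs (insert v V). weight J (insert v V) h \<sigma> * of_real (\<sigma> v)) =
    exp (h v) * Z V (\<lambda>u. h u + J v u) - exp (- h v) * Z V (\<lambda>u. h u - J v u)"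
  unfolding partition_function_def sum_spin_configs_insert[OF assms(2)]
  by (simp add: weight_insert[OF assms] sum_distrib_left sum_negf)

text \<open>
  The partition function depends on the field at a single site only through \<open>exp t\<close> and \<open>exp (- t)\<close>, with
  coefficients whose quotient is the cavity ratio.
\<close>

lemma partition_function_upd:
  fixes h :: "'v \<Rightarrow> complex"
  assumes "finite V" "v \<notin> V" "Z V (\<lambda>u. h u - J v u) \<noteq> 0"
  shows "Z (insert v V) (h(v := h v + t)) =
         exp (- h v) * Z V (\<lambda>u. h u - J v u) * (exp t * cavity_ratio J V v h + exp (- t))"
proof -
  have "Z V (\<lambda>u. (h(v := h v + t)) u + J v u) = Z V (\<lambda>u. h u + J v u)"
       "Z V (\<lambda>u. (h(v := h v + t)) u - J v u) = Z V (\<lambda>u. h u - J v u)"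
    using assms(2) by (auto intro!: partition_function_cong)
  moreover have "exp (2 * h v) = exp (h v) * exp (h v)"
    by (simp add: exp_add[symmetric])
  ultimately show ?thesis
    using assms by (simp add: partition_function_insert cavity_ratio_def exp_add exp_diff exp_minus
      field_simps)
qed

section \<open>Absence of zeros in a strip\<close>

text \<open>
  For a field in this strip \<open>exp (2 * h v)\<close> has argument at most 1 in absolute value, which is less than \<open>\<pi> / 3\<close>;
  so its cosine is at least 1/2. The real parts are unrestricted, and the strip is therefore invariant under the
  shifts by real couplings that occur in the recursion.
\<close>

definition strip :: "('v \<Rightarrow> complex) \<Rightarrow> bool" where
  "strip h \<longleftrightarrow> (\<forall>v. \<bar>Im (h v)\<bar> \<le> 1 / 2)"

lemma strip_add_real: "strip h \<Longrightarrow> strip (\<lambda>u. h u + of_real (t u))"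
  and strip_diff_real: "strip h \<Longrightarrow> strip (\<lambda>u. h u - of_real (t u))"
  and strip_upd_real: "strip h \<Longrightarrow> strip (h(u := h u + of_real x))"
  by (auto simp: strip_def)

lemma exp_2K: "exp (2 * K) - 1 \<le> 4 * K"
  using exp_bound[of "2 * K"] K_nonneg K_small mult_left_mono[of "2 * K" 1 "2 * K"]
  by (simp add: power2_eq_square)

text \<open>
  The shift on \<open>insert u S\<close> is split by an intermediate field that is raised at \<open>u\<close> and lowered on \<open>S\<close>.
\<close>

lemma shift_ratio_insert:
  assumes "u \<notin> S"
    and "Z V (\<lambda>w. (h(u := h u + of_real (t u))) w - of_real (if w \<in> S then t w else 0)) \<noteq> 0"
  shows "shift_ratio J V (insert u S) t h =
    shift_ratio J V S t (h(u := h u + of_real (t u))) *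
    shift_ratio J V {u} t (\<lambda>w. h w - of_real (if w \<in> S then t w else 0))"
proof -
  define g k where "g = h(u := h u + of_real (t u))"
    and "k = (\<lambda>w. h w - of_real (if w \<in> S then t w else 0))"
  have eq: "(\<lambda>w. h w + of_real (if w \<in> insert u S then t w else 0)) =
            (\<lambda>w. g w + of_real (if w \<in> S then t w else 0))"
           "(\<lambda>w. h w - of_real (if w \<in> insert u S then t w else 0)) =
            (\<lambda>w. k w - of_real (if w \<in> {u} then t w else 0))"
           "(\<lambda>w. g w - of_real (if w \<in> S then t w else 0)) =
            (\<lambda>w. k w + of_real (if w \<in> {u} then t w else 0))"
    using assms(1) by (auto simp: g_def k_def fun_eq_iff)
  show ?thesis
    using assms(2) unfolding shift_ratio_def g_def[symmetric] k_def[symmetric] eq by simp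
qed

lemma shift_ratio_singleton:
  fixes h :: "'v \<Rightarrow> complex"
  assumes "finite W" "u \<notin> W" "Z W (\<lambda>w. h w - J u w) \<noteq> 0"
  shows "shift_ratio J (insert u W) {u} t h =
    (exp (of_real (t u)) * cavity_ratio J W u h + exp (- of_real (t u))) /
    (exp (- of_real (t u)) * cavity_ratio J W u h + exp (of_real (t u)))"
proof -
  have "(\<lambda>w. h w + of_real (if w \<in> {u} then t w else 0)) = h(u := h u + of_real (t u))"
       "(\<lambda>w. h w - of_real (if w \<in> {u} then t w else 0)) = h(u := h u + - of_real (t u))"
    by auto
  then show ?thesis
    using assms unfolding shift_ratio_def
    by (simp only: partition_function_upd[OF assms]) simp
qed

lemma cavity_ratio_eq_shift_ratio:
  "cavity_ratio J V v h = exp (2 * h v) * shift_ratio J V V (J v) h"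
proof -
  have "Z V (\<lambda>u. h u + of_real (if u \<in> V then J v u else 0)) = Z V (\<lambda>u. h u + of_real (J v u))"
       "Z V (\<lambda>u. h u - of_real (if u \<in> V then J v u else 0)) = Z V (\<lambda>u. h u - of_real (J v u))"
    by (rule partition_function_cong; simp)+
  then show ?thesis by (simp add: cavity_ratio_def shift_ratio_def)
qed

text \<open>
  Multiplication of \<open>exp (2 * h v)\<close>, whose argument has cosine at least 1/2, by a number within distance 1/2 of 1
  does not leave the closed right half-plane.
\<close>

lemma cavity_ratio_nonneg_Re:
  assumes "\<bar>Im (h v)\<bar> \<le> 1 / 2" and "cmod (shift_ratio J V V (J v) h - 1) \<le> 1 / 2"
  shows "Re (cavity_ratio J V v h) \<ge> 0"
proof -
  define w where "w = shift_ratio J V V (J v) h - 1"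
  have "cos (pi / 3) \<le> cos \<bar>2 * Im (h v)\<bar>"
    using assms(1) pi_gt3 by (intro cos_monotone_0_pi_le) auto
  then have c: "cos (2 * Im (h v)) \<ge> 1 / 2"
    unfolding cos_abs_real by (simp add: cos_60)
  have "\<bar>Re (cis (2 * Im (h v)) * w)\<bar> \<le> 1 / 2"
    using abs_Re_le_cmod[of "cis (2 * Im (h v)) * w"] assms(2) by (simp add: norm_mult w_def)
  moreover have "Re (cis (2 * Im (h v)) * (1 + w)) = cos (2 * Im (h v)) + Re (cis (2 * Im (h v)) * w)"
    by (simp add: distrib_left)
  ultimately have "Re (cis (2 * Im (h v)) * (1 + w)) \<ge> 0"
    using c by linarith
  moreover have "cavity_ratio J V v h = of_real (exp (2 * Re (h v))) * (cis (2 * Im (h v)) * (1 + w))"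
    by (simp add: cavity_ratio_eq_shift_ratio w_def exp_eq_polar)
  ultimately show ?thesis
    by (simp add: mult_nonneg_nonneg Re_complex_of_real)
qed

text \<open>
  Both claims are proved together by induction on the set of sites. The second one, for the set without a site \<open>v\<close>,
  puts the cavity ratio of \<open>v\<close> into the right half-plane. Hence \<open>1 + R \<noteq> 0\<close>, which is the first claim, and a shift
  at \<open>v\<close> alone changes the partition function by a factor near 1. Shifts on larger sets are products of such
  factors.
\<close>

proposition
  assumes "finite V" "strip h"
  shows partition_function_nonzero: "Z V h \<noteq> 0"
    and shift_ratio_near_one:
      "S \<subseteq> V \<Longrightarrow> (\<And>u. 0 \<le> t u) \<Longrightarrow> cmod (shift_ratio J V S t h - 1) \<le> exp (2 * sum t S) - 1"
proof -
  have "Z V h \<noteq> 0 \<and> (\<forall>S t. S \<subseteq> V \<longrightarrow> (\<forall>u. 0 \<le> t u) \<longrightarrow>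
       cmod (shift_ratio J V S t h - 1) \<le> exp (2 * sum t S) - 1)"
    using assms
  proof (induction V arbitrary: h rule: finite_psubset_induct)
    case (psubset V)
    have cavity: "finite W" "Z W (\<lambda>u. g u - of_real (J v u)) \<noteq> 0" "Re (cavity_ratio J W v g) \<ge> 0"
      if "V = insert v W" "v \<notin> W" "strip g" for v W g
    proof -
      have W: "W \<subset> V" using that by auto
      then show fW: "finite W" using psubset.hyps(1) finite_subset by blast
      show "Z W (\<lambda>u. g u - of_real (J v u)) \<noteq> 0"
        using psubset.IH[OF W strip_diff_real[OF that(3)]] by blast
      have "(\<forall>u. 0 \<le> J v u)" by (simp add: nonneg)
      then have "cmod (shift_ratio J W W (J v) g - 1) \<le> exp (2 * sum (J v) W) - 1"
        using psubset.IH[OF W that(3)] by blast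
      also have "exp (2 * sum (J v) W) - 1 \<le> exp (2 * K) - 1"
        using row_sum[OF fW] by simp
      also have "\<dots> \<le> 1 / 2" using exp_2K K_small by linarith
      finally show "Re (cavity_ratio J W v g) \<ge> 0"
        using that(3) by (intro cavity_ratio_nonneg_Re) (auto simp: strip_def)
    qed
    \<comment> \<open>The partition function is a nonzero multiple of 1 + R.\<close>
    have nz: "Z V g \<noteq> 0" if g: "strip g" for g
    proof (cases "V = {}")
      case False
      then obtain v W where vW: "V = insert v W" "v \<notin> W" by (metis all_not_in_conv mk_disjoint_insert)
      note c = cavity[OF vW g]
      have "Re (1 + cavity_ratio J W v g) > 0" using c(3) by simp
      then have "1 + cavity_ratio J W v g \<noteq> 0" by fastforce
      then show ?thesis
        using partition_function_upd[OF c(1) vW(2) c(2), of 0] c(2) vW(1) by (simp add: add.commute)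
    qed (simp add: partition_function_empty)
    have single: "cmod (shift_ratio J V {v} t g - 1) \<le> exp (2 * t v) - 1"
      if g: "strip g" and v: "v \<in> V" and t: "0 \<le> t v" for g v t
    proof -
      obtain W where vW: "V = insert v W" "v \<notin> W" using v by (meson mk_disjoint_insert)
      note c = cavity[OF vW g]
      show ?thesis
        unfolding vW(1) shift_ratio_singleton[OF c(1) vW(2) c(2)] by (rule moebius_near_one[OF c(3) t])
    qed
    have "cmod (shift_ratio J V S t h - 1) \<le> exp (2 * sum t S) - 1"
      if "S \<subseteq> V" "\<forall>u. 0 \<le> t u" for S t
    proof -
      have "finite S" using that psubset.hyps finite_subset by blast
      then show ?thesis using that(1) \<open>strip h\<close>
      proof (induction S arbitrary: h rule: finite_induct)
        case empty
        then show ?case using nz by (simp add: shift_ratio_def)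
      next
        case (insert u S)
        have "shift_ratio J V (insert u S) t h = shift_ratio J V S t (h(u := h u + of_real (t u))) *
          shift_ratio J V {u} t (\<lambda>w. h w - of_real (if w \<in> S then t w else 0))"
          by (intro shift_ratio_insert nz strip_diff_real strip_upd_real insert)
        also have "cmod (\<dots> - 1) \<le> exp (2 * sum t S) * exp (2 * t u) - 1"
          using insert.prems that(2)
          by (intro norm_mult_minus_one_le insert.IH single strip_diff_real strip_upd_real) auto
        also have "exp (2 * sum t S) * exp (2 * t u) - 1 = exp (2 * sum t (insert u S)) - 1"
          using insert.hyps by (simp add: exp_add distrib_left)
        finally show ?case .
      qed
    qed
    then show ?case using nz \<open>strip h\<close> by blast
  qed
  then show "Z V h \<noteq> 0"
    and "S \<subseteq> V \<Longrightarrow> (\<And>u. 0 \<le> t u) \<Longrightarrow> cmod (shift_ratio J V S t h - 1) \<le> exp (2 * sum t S) - 1"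
    by blast+
qed

lemma cavity_shift_ratio_bound:
  assumes "finite V" "strip h"
  shows "cmod (shift_ratio J V V (J v) h - 1) \<le> 4 * K"
proof -
  have "cmod (shift_ratio J V V (J v) h - 1) \<le> exp (2 * sum (J v) V) - 1"
    by (rule shift_ratio_near_one[OF assms order_refl nonneg])
  also have "\<dots> \<le> exp (2 * K) - 1" using row_sum[OF assms(1)] by simp
  finally show ?thesis using exp_2K by linarith
qed

lemma Re_cavity_ratio: "finite V \<Longrightarrow> strip h \<Longrightarrow> Re (cavity_ratio J V v h) \<ge> 0"
  using cavity_shift_ratio_bound[of V h v] K_small
  by (intro cavity_ratio_nonneg_Re) (auto simp: strip_def)

lemma cavity_ratio_nonzero:
  assumes "finite V" "strip h"
  shows "cavity_ratio J V v h \<noteq> 0"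
  using partition_function_nonzero[OF assms(1) strip_add_real[OF assms(2)]]
        partition_function_nonzero[OF assms(1) strip_diff_real[OF assms(2)]]
  by (simp add: cavity_ratio_def)

definition spin_mean :: "'v set \<Rightarrow> ('v \<Rightarrow> complex) \<Rightarrow> 'v \<Rightarrow> complex" where
  "spin_mean V h v = (\<Sum>\<sigma>\<in>spin_configs V. weight J V h \<sigma> * of_real (\<sigma> v)) / Z V h"

lemma spin_mean_eq:
  assumes "finite V" "strip h" "v \<notin> V"
  shows "spin_mean (insert v V) h v = (cavity_ratio J V v h - 1) / (cavity_ratio J V v h + 1)"
proof -
  define R where "R = cavity_ratio J V v h"
  define M where "M = exp (- h v) * Z V (\<lambda>u. h u - J v u)"
  have nz: "Z V (\<lambda>u. h u - J v u) \<noteq> 0"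
    by (rule partition_function_nonzero[OF assms(1) strip_diff_real[OF assms(2)]])
  have "exp (h v) * Z V (\<lambda>u. h u + J v u) = M * R"
    using nz by (simp add: M_def R_def cavity_ratio_def exp_add[symmetric])
  then have "spin_mean (insert v V) h v = (M * (R - 1)) / (M * (R + 1))"
    unfolding spin_mean_def sum_spin_weight_insert[OF assms(1,3)] partition_function_insert[OF assms(1,3)]
    by (simp add: M_def algebra_simps)
  then show ?thesis using nz by (simp add: M_def R_def)
qed

text \<open>
  If the cavity ratio were equal to its free part \<open>exp (2 * h v)\<close>, then the mean spin would be \<open>tanh (h v)\<close>.
\<close>

lemma spin_mean_near_tanh:
  assumes "finite V" "strip h" "v \<in> V"
  shows "cmod (spin_mean V h v - tanh (h v)) \<le> 8 * K" and "cmod (spin_mean V h v) \<le> 1"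
proof -
  obtain W where W: "V = insert v W" "v \<notin> W" using assms(3) by (meson mk_disjoint_insert)
  have fW: "finite W" using W assms by simp
  define R E where "R = cavity_ratio J W v h" and "E = exp (2 * h v)"
  have Re: "Re R \<ge> 0" "Re E \<ge> 0"
    using assms Re_cavity_ratio[OF fW assms(2)] Re_exp_strip by (auto simp: R_def E_def strip_def)
  have m: "spin_mean V h v = (R - 1) / (R + 1)" "tanh (h v) = (E - 1) / (E + 1)"
    unfolding W(1) spin_mean_eq[OF fW assms(2) W(2)] tanh_cayley by (simp_all add: R_def E_def)
  show "cmod (spin_mean V h v) \<le> 1" unfolding m using cayley_diff(2) Re by blast
  have "R - E = E * (shift_ratio J W W (J v) h - 1)"
    by (simp add: R_def E_def cavity_ratio_eq_shift_ratio algebra_simps)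
  then have "cmod (R - E) \<le> cmod E * (4 * K)"
    using cavity_shift_ratio_bound[OF fW assms(2)] by (simp add: norm_mult mult_left_mono)
  then have "cmod ((R - 1) / (R + 1) - (E - 1) / (E + 1)) * cmod E \<le> (8 * K) * cmod E"
    using cayley_diff(1)[OF Re] by (simp add: mult_ac)
  moreover have "cmod E > 0" by (simp add: E_def)
  ultimately show "cmod (spin_mean V h v - tanh (h v)) \<le> 8 * K"
    unfolding m by (simp only: mult_le_cancel_right_pos)
qed

end

section \<open>Decay of the influence of distant fields\<close>

text \<open>
  The logarithmic derivative of the Moebius function, as a function of \<open>ln R\<close>, is small for small \<open>t\<close>. The
  multiplicative formulation avoids branches of the logarithm.
\<close>

lemma moebius_contract:
  fixes t :: real and R R' :: complex
  defines "f \<equiv> \<lambda>R. (exp (of_real t) * R + exp (- of_real t)) / (exp (- of_real t) * R + exp (of_real t))"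
  assumes "Re R \<ge> 0" "Re R' \<ge> 0" "R' \<noteq> 0" "t \<ge> 0"
  shows "cmod (f R / f R' - 1) \<le> (exp (4 * t) - 1) * cmod (R / R' - 1)"
proof -
  define b where "b = exp (2 * t)"
  have b: "b \<ge> 1" using assms by (simp add: b_def)
  have f: "f S = (of_real b * S + 1) / (S + of_real b)" for S
  proof -
    have et: "exp (of_real t) = exp (- of_real t) * complex_of_real b"
      by (simp add: b_def exp_of_real[symmetric] exp_add[symmetric])
    have "exp (- of_real t) * S + exp (of_real t) = exp (- of_real t) * (S + of_real b)"
         "exp (of_real t) * S + exp (- of_real t) = exp (- of_real t) * (of_real b * S + 1)"
      by (simp_all add: et algebra_simps)
    then show ?thesis by (simp add: f_def)
  qed
  have "Re (R + of_real b) > 0" "Re (R' + of_real b) > 0" "Re (of_real b * R' + 1) > 0"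
    using assms b by (auto intro: add_nonneg_pos)
  then have nz: "R + of_real b \<noteq> 0" "R' + of_real b \<noteq> 0" "of_real b * R' + 1 \<noteq> 0" by fastforce+
  have n1: "cmod (R + of_real b) \<ge> b"
    using complex_Re_le_cmod[of "R + of_real b"] assms by simp
  have n2: "cmod (of_real b * R' + 1) \<ge> b * cmod R'"
  proof -
    have "cmod (of_real b * R') \<le> cmod (of_real b * R' + 1)"
      unfolding cmod_def using assms b
      by (intro real_sqrt_le_mono) (auto simp: power2_eq_square algebra_simps)
    then show ?thesis using b by (simp add: norm_mult)
  qed
  have "f R / f R' - 1 = of_real (b\<^sup>2 - 1) * ((R / R' - 1) * (R' / ((R + of_real b) * (of_real b * R' + 1))))"
  proof -
    have "f R / f R' - 1 = ((of_real b * R + 1) * (R' + of_real b)) / ((R + of_real b) * (of_real b * R' + 1)) - 1"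
      unfolding f by simp
    also have "\<dots> = ((of_real b * R + 1) * (R' + of_real b) - (R + of_real b) * (of_real b * R' + 1)) /
        ((R + of_real b) * (of_real b * R' + 1))"
      using nz by (simp add: diff_divide_distrib)
    also have "(of_real b * R + 1) * (R' + of_real b) - (R + of_real b) * (of_real b * R' + 1) =
        of_real (b\<^sup>2 - 1) * ((R / R' - 1) * R')"
      using assms(4) by (simp add: algebra_simps power2_eq_square)
    finally show ?thesis by simp
  qed
  then have "cmod (f R / f R' - 1) = (b\<^sup>2 - 1) * (cmod (R / R' - 1) * (cmod R' / (cmod (R + of_real b) * cmod (of_real b * R' + 1))))"
    using b by (simp only: norm_mult norm_divide norm_of_real) simp
  also have "\<dots> \<le> (b\<^sup>2 - 1) * (cmod (R / R' - 1) * 1)"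
  proof -
    have "cmod R' \<le> b * (b * cmod R')"
      using mult_mono[of 1 b 1 b] b mult_right_mono[of 1 "b * b" "cmod R'"] by (simp add: mult_ac)
    also have "\<dots> \<le> cmod (R + of_real b) * cmod (of_real b * R' + 1)"
      using n1 n2 b by (intro mult_mono) auto
    finally have "cmod R' / (cmod (R + of_real b) * cmod (of_real b * R' + 1)) \<le> 1"
      using nz by (simp add: divide_le_eq)
    then show ?thesis using b by (intro mult_left_mono) auto
  qed
  also have "b\<^sup>2 = exp (4 * t)" by (simp add: b_def power2_eq_square exp_add[symmetric])
  finally show ?thesis by simp
qed

context ferromagnet begin

lemma shift_ratio_nonzero:
  assumes "finite V" "strip h"
  shows "shift_ratio J V S t h \<noteq> 0"
  using partition_function_nonzero[OF assms(1) strip_add_real[OF assms(2)]]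
        partition_function_nonzero[OF assms(1) strip_diff_real[OF assms(2)]]
  by (simp add: shift_ratio_def)

lemma shift_ratio_zero:
  assumes "finite V" "strip h" "\<And>u. u \<in> S \<Longrightarrow> t u = 0"
  shows "shift_ratio J V S t h = 1"
proof -
  have "(if u \<in> S then t u else 0) = 0" for u using assms(3) by simp
  then show ?thesis using partition_function_nonzero[OF assms(1,2)] by (simp add: shift_ratio_def)
qed

text \<open>
  The sets \<open>A k\<close> play the role of the points at distance at least \<open>k\<close> from the region where the two fields differ.
  By the recursion, the relative difference of the cavity ratios at a point of \<open>A (Suc k)\<close> is, to first order, at most the sum over the
  neighbors, which lie in \<open>A k\<close>, of \<open>exp (4 * J v u) - 1\<close> times the relative difference there; each step thus
  gains a factor \<open>16 * K\<close>. For \<open>k = 0\<close> both ratios are compared with \<open>exp (2 * h v)\<close> and \<open>exp (2 * h' v)\<close>.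
\<close>

proposition cavity_ratio_decay:
  fixes A :: "nat \<Rightarrow> 'v set"
  assumes A: "A 0 = UNIV" "\<And>k v u. v \<in> A (Suc k) \<Longrightarrow> J v u \<noteq> 0 \<Longrightarrow> u \<in> A k"
    and "finite V" "strip h" "strip h'"
    and "\<And>u. cmod (h u - h' u) \<le> K"
    and "\<And>k u. u \<in> A (Suc k) \<Longrightarrow> h u = h' u"
    and "v \<in> A k"
  shows "cmod (cavity_ratio J V v h / cavity_ratio J V v h' - 1) \<le> 7 * (16 * K) ^ k"
  using assms(3-)
proof (induction V arbitrary: h h' v k rule: finite_psubset_induct)
  case (psubset V)
  note fV = psubset.hyps and h = psubset.prems(1,2) and close = psubset.prems(3) and agree = psubset.prems(4)
  define q q' where "q = shift_ratio J V V (J v) h" and "q' = shift_ratio J V V (J v) h'"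
  have q: "cmod (q - 1) \<le> 4 * K" "cmod (q' - 1) \<le> 4 * K" "q' \<noteq> 0"
    unfolding q_def q'_def by (intro cavity_shift_ratio_bound shift_ratio_nonzero fV h)+
  have x: "cavity_ratio J V v h / cavity_ratio J V v h' = exp (2 * (h v - h' v)) * (q / q')"
    by (simp add: cavity_ratio_eq_shift_ratio q_def q'_def exp_diff right_diff_distrib)
  show ?case
  proof (cases k)
    case 0
    have "cmod (exp (2 * (h v - h' v))) \<le> exp (2 * K)"
      using abs_Re_le_cmod[of "h v - h' v"] close[of v] by (simp add: norm_exp_eq_Re)
    also have "\<dots> \<le> 2" using exp_2K K_small by linarith
    finally have e: "cmod (exp (2 * (h v - h' v))) \<le> 2" .
    have q1: "cmod q \<le> 2" using norm_triangle_sub[of q 1] q K_small by simp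
    have q2: "cmod q' \<ge> 2 / 3" using norm_triangle_sub[of 1 q'] q K_small by (simp add: norm_minus_commute)
    have "cmod (q / q') \<le> 2 / (2 / 3)"
      using q1 q2 unfolding norm_divide by (intro frac_le) auto
    then have "cmod (exp (2 * (h v - h' v)) * (q / q')) \<le> 2 * 3"
      using e unfolding norm_mult by (intro mult_mono) auto
    then show ?thesis
      using norm_triangle_ineq4[of "exp (2 * (h v - h' v)) * (q / q')" 1] unfolding x 0 by simp
  next
    case (Suc j)
    define M where "M = 7 * (16 * K) ^ j"
    have "(16 * K) ^ j \<le> 1" using K_nonneg K_small by (intro power_le_one) auto
    then have M: "0 \<le> M" "M \<le> 7" using K_nonneg by (auto simp: M_def)
    have single: "cmod (shift_ratio J V {u} (J v) g / shift_ratio J V {u} (J v) g' - 1) \<le> exp (8 * M * J v u) - 1"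
      if u: "u \<in> V" and g: "strip g" "strip g'" "\<And>w. cmod (g w - g' w) \<le> K"
         "\<And>k w. w \<in> A (Suc k) \<Longrightarrow> g w = g' w" for u g g'
    proof (cases "J v u = 0")
      case True
      then show ?thesis
        using shift_ratio_zero[OF fV g(1), of "{u}" "J v"] shift_ratio_zero[OF fV g(2), of "{u}" "J v"] by simp
    next
      case False
      then have uA: "u \<in> A j" using A(2) psubset.prems(5) Suc by blast
      obtain W where W: "V = insert u W" "u \<notin> W" using u by (meson mk_disjoint_insert)
      have fW: "finite W" "W \<subset> V" using W fV by auto
      have nz: "Z W (\<lambda>w. g w - J u w) \<noteq> 0" "Z W (\<lambda>w. g' w - J u w) \<noteq> 0"
        by (intro partition_function_nonzero fW strip_diff_real g)+
      have "J v u \<le> K" using row_sum[of "{u}" v] by simp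
      then have "8 * J v u \<le> 1" using K_small K_nonneg by linarith
      then have "exp (4 * J v u) - 1 \<le> 8 * J v u"
        using exp_minus_one_le[of "4 * J v u"] nonneg[of v u] by simp
      moreover have "cmod (cavity_ratio J W u g / cavity_ratio J W u g' - 1) \<le> M"
        unfolding M_def by (rule psubset.IH[OF fW(2) g uA])
      ultimately have "(exp (4 * J v u) - 1) * cmod (cavity_ratio J W u g / cavity_ratio J W u g' - 1) \<le> (8 * J v u) * M"
        using nonneg[of v u] by (intro mult_mono) auto
      also have "\<dots> \<le> exp (8 * M * J v u) - 1"
        using exp_ge_add_one_self[of "8 * M * J v u"] unfolding mult.commute[of _ M] mult.assoc[symmetric]
        by linarith
      finally have "(exp (4 * J v u) - 1) * cmod (cavity_ratio J W u g / cavity_ratio J W u g' - 1) \<le> exp (8 * M * J v u) - 1" .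
      then show ?thesis
        unfolding W(1) shift_ratio_singleton[OF fW(1) W(2) nz(1)] shift_ratio_singleton[OF fW(1) W(2) nz(2)]
        using moebius_contract[OF Re_cavity_ratio[OF fW(1) g(1)] Re_cavity_ratio[OF fW(1) g(2)]
             cavity_ratio_nonzero[OF fW(1) g(2)] nonneg]
        by (rule order_trans[rotated])
    qed
    \<comment> \<open>The shifts are made one site at a time, simultaneously for both fields.\<close>
    have telescope: "cmod (shift_ratio J V S (J v) g / shift_ratio J V S (J v) g' - 1) \<le> exp (8 * M * sum (J v) S) - 1"
      if "finite S" "S \<subseteq> V" and "strip g" "strip g'" "\<And>w. cmod (g w - g' w) \<le> K"
         "\<And>k w. w \<in> A (Suc k) \<Longrightarrow> g w = g' w" for S g g'
      using that
    proof (induction S arbitrary: g g' rule: finite_induct)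
      case empty
      then show ?case
        using shift_ratio_zero[OF fV, of g "{}" "J v"] shift_ratio_zero[OF fV, of g' "{}" "J v"] by simp
    next
      case (insert u S)
      define k k' where "k = (\<lambda>w. g w - of_real (if w \<in> S then J v w else 0))"
        and "k' = (\<lambda>w. g' w - of_real (if w \<in> S then J v w else 0))"
      have tel: "shift_ratio J V (insert u S) (J v) f = shift_ratio J V S (J v) (f(u := f u + of_real (J v u))) *
          shift_ratio J V {u} (J v) (\<lambda>w. f w - of_real (if w \<in> S then J v w else 0))" if "strip f" for f
        by (intro shift_ratio_insert insert.hyps partition_function_nonzero fV strip_diff_real strip_upd_real that)
      have eq: "shift_ratio J V (insert u S) (J v) g / shift_ratio J V (insert u S) (J v) g' =
        (shift_ratio J V S (J v) (g(u := g u + of_real (J v u))) / shift_ratio J V S (J v) (g'(u := g' u + of_real (J v u)))) *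
        (shift_ratio J V {u} (J v) k / shift_ratio J V {u} (J v) k')"
        unfolding tel[OF insert.prems(2)] tel[OF insert.prems(3)] k_def k'_def by simp
      have "cmod (shift_ratio J V (insert u S) (J v) g / shift_ratio J V (insert u S) (J v) g' - 1)
          \<le> exp (8 * M * sum (J v) S) * exp (8 * M * J v u) - 1"
        unfolding eq
      proof (intro norm_mult_minus_one_le insert.IH single)
        show "S \<subseteq> V" "u \<in> V" using insert.prems(1) by auto
        show "strip (g(u := g u + of_real (J v u)))" "strip (g'(u := g' u + of_real (J v u)))"
          by (intro strip_upd_real insert.prems(2,3))+
        show "strip k" "strip k'" unfolding k_def k'_def by (intro strip_diff_real insert.prems(2,3))+
        show "cmod ((g(u := g u + of_real (J v u))) w - (g'(u := g' u + of_real (J v u))) w) \<le> K" for w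
          using insert.prems(4)[of w] insert.prems(4)[of u] by simp
        show "cmod (k w - k' w) \<le> K" for w
          using insert.prems(4)[of w] by (simp add: k_def k'_def)
        fix i w assume "w \<in> A (Suc i)"
        then have "g w = g' w" by (rule insert.prems(5))
        then show "(g(u := g u + of_real (J v u))) w = (g'(u := g' u + of_real (J v u))) w" "k w = k' w"
          by (auto simp: k_def k'_def)
      qed
      also have "exp (8 * M * sum (J v) S) * exp (8 * M * J v u) - 1 = exp (8 * M * sum (J v) (insert u S)) - 1"
        by (simp only: sum.insert[OF insert.hyps] distrib_left exp_add mult.commute)
      finally show ?case .
    qed
    have "cmod (q / q' - 1) \<le> exp (8 * M * sum (J v) V) - 1"
      unfolding q_def q'_def using close agree by (intro telescope fV order_refl h) auto
    also have "\<dots> \<le> exp (8 * M * K) - 1"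
      using M row_sum[OF fV, of v] by (simp add: mult_left_mono)
    also have "\<dots> \<le> 16 * M * K"
    proof -
      have "8 * M * K \<le> 8 * 7 * K" using M K_nonneg by (intro mult_right_mono) auto
      then have le: "8 * M * K \<le> 1" using K_small K_nonneg by linarith
      show ?thesis
        using exp_minus_one_le[of "8 * M * K"] le M K_nonneg by simp
    qed
    finally show ?thesis
      using agree[of v j] psubset.prems(5) unfolding x Suc by (simp add: M_def mult_ac)
  qed
qed

lemma flip_spin_configs:
  assumes "\<sigma> \<in> spin_configs V"
  shows "(\<lambda>v\<in>V. - \<sigma> v) \<in> spin_configs V" and "(\<lambda>v\<in>V. - (\<lambda>v\<in>V. - \<sigma> v) v) = \<sigma>"
proof -
  show "(\<lambda>v\<in>V. - \<sigma> v) \<in> spin_configs V"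
    using assms by (force simp: spin_configs_def PiE_iff)
  show "(\<lambda>v\<in>V. - (\<lambda>v\<in>V. - \<sigma> v) v) = \<sigma>"
    using assms by (intro ext) (auto simp: spin_configs_def PiE_iff extensional_def)
qed

lemma sum_spin_configs_flip:
  "(\<Sum>\<sigma>\<in>spin_configs V. g (\<lambda>v\<in>V. - \<sigma> v)) = (\<Sum>\<sigma>\<in>spin_configs V. g \<sigma>)"
  by (rule sum.reindex_bij_witness[where i = "\<lambda>\<sigma>. \<lambda>v\<in>V. - \<sigma> v" and j = "\<lambda>\<sigma>. \<lambda>v\<in>V. - \<sigma> v"])
     (simp_all only: flip_spin_configs)

lemma pair_energy_flip: "pair_energy J V (\<lambda>v\<in>V. - \<sigma> v) = pair_energy J V \<sigma>"
  by (simp add: pair_energy_def)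

lemma partition_function_neg:
  "Z V (\<lambda>u. - h u) = Z V h"
  unfolding partition_function_def
  by (subst sum_spin_configs_flip[symmetric]) (simp add: weight_def pair_energy_flip)

text \<open>
  Without a field the model is symmetric under a global flip of the spins.
\<close>

lemma cavity_ratio_zero_field:
  assumes "finite V"
  shows "cavity_ratio J V v (\<lambda>_. 0) = 1"
  using partition_function_neg[of V "\<lambda>u. complex_of_real (J v u)"]
    partition_function_nonzero[OF assms, of "\<lambda>u. complex_of_real (J v u)"]
  by (simp add: cavity_ratio_def strip_def)

text \<open>
  The mean spin in zero field vanishes, so it suffices to compare \<open>h\<close> with the zero field.
\<close>

corollary spin_mean_decay:
  fixes A :: "nat \<Rightarrow> 'v set"
  assumes A: "A 0 = UNIV" "\<And>k v u. v \<in> A (Suc k) \<Longrightarrow> J v u \<noteq> 0 \<Longrightarrow> u \<in> A k"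
    and "finite V" "strip h"
    and "\<And>u. cmod (h u) \<le> K"
    and "\<And>k u. u \<in> A (Suc k) \<Longrightarrow> h u = 0"
    and "v \<in> A k" "v \<in> V"
  shows "cmod (spin_mean V h v) \<le> 14 * (16 * K) ^ k"
proof -
  obtain W where W: "V = insert v W" "v \<notin> W" using \<open>v \<in> V\<close> by (meson mk_disjoint_insert)
  have fW: "finite W" using W assms by simp
  define R where "R = cavity_ratio J W v h"
  have s0: "strip (\<lambda>_. 0)" by (simp add: strip_def)
  have "cmod (R / cavity_ratio J W v (\<lambda>_. 0) - 1) \<le> 7 * (16 * K) ^ k"
    unfolding R_def by (rule cavity_ratio_decay[where A = A, OF _ _ fW assms(4) s0]) (use assms in auto)
  then have R: "cmod (R - 1) \<le> 7 * (16 * K) ^ k"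
    by (simp add: cavity_ratio_zero_field[OF fW])
  have "spin_mean V h v = (R - 1) / (R + 1)"
    unfolding W(1) R_def by (rule spin_mean_eq[OF fW assms(4) W(2)])
  then show ?thesis
    using cayley_diff(1)[of R 1] Re_cavity_ratio[OF fW assms(4), of v] R by (simp add: R_def)
qed

end

section \<open>Odd functions close to the hyperbolic tangent\<close>

text \<open>
  By Cauchy's estimates the tail of the power series is dominated by a geometric series with ratio
  \<open>cmod z / r \<le> 1 / 2\<close>.
\<close>

lemma holomorphic_taylor_remainder:
  assumes holo: "f holomorphic_on ball 0 r" and cont: "continuous_on (cball 0 r) f"
    and bound: "\<And>z. z \<in> cball 0 r \<Longrightarrow> cmod (f z) \<le> B" and "0 < r" "cmod z \<le> r / 2"
  shows "cmod (f z - (\<Sum>k<n. (deriv ^^ k) f 0 / fact k * z ^ k)) \<le> 2 * B * (cmod z / r) ^ n"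
proof -
  define c where "c k = (deriv ^^ k) f 0 / fact k" for k
  define q where "q = cmod z / r"
  have q: "0 \<le> q" "q \<le> 1 / 2" using assms by (auto simp: q_def field_simps)
  have c: "cmod (c k) \<le> B / r ^ k" for k
  proof -
    have "cmod ((deriv ^^ k) f 0) \<le> fact k * B / r ^ k"
      by (rule Cauchy_inequality[OF holo cont \<open>0 < r\<close>]) (simp add: bound)
    then show ?thesis by (simp add: c_def norm_divide field_simps)
  qed
  have "0 \<le> B" using order_trans[OF norm_ge_zero bound[of 0]] \<open>0 < r\<close> by simp
  have sums: "(\<lambda>k. c k * z ^ k) sums f z"
    using holomorphic_power_series[OF holo, of z] assms by (simp add: c_def)
  then have sums': "(\<lambda>k. c (k + n) * z ^ (k + n)) sums (f z - (\<Sum>k<n. c k * z ^ k))"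
    by (rule sums_split_initial_segment)
  have term_le: "cmod (c (k + n) * z ^ (k + n)) \<le> B * q ^ n * q ^ k" for k
  proof -
    have "cmod (c (k + n) * z ^ (k + n)) \<le> B / r ^ (k + n) * cmod z ^ (k + n)"
      unfolding norm_mult norm_power by (intro mult_right_mono c) auto
    then show ?thesis by (simp add: q_def power_add power_divide mult_ac)
  qed
  have geo: "(\<lambda>k. B * q ^ n * q ^ k) sums (B * q ^ n * (1 / (1 - q)))"
    using q by (intro sums_mult geometric_sums) auto
  have "cmod (f z - (\<Sum>k<n. c k * z ^ k)) \<le> B * q ^ n * (1 / (1 - q))"
    by (rule norm_sums_le[OF sums' geo term_le])
  also have "\<dots> \<le> B * q ^ n * 2"
    using q \<open>0 \<le> B\<close> by (intro mult_left_mono) (auto simp: field_simps)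
  finally show ?thesis by (simp add: c_def q_def mult_ac)
qed

text \<open>
  The even Taylor terms disappear on taking half the difference of the expansions at \<open>z\<close> and \<open>- z\<close>.
\<close>

lemma odd_holomorphic_taylor:
  assumes holo: "f holomorphic_on ball 0 r" and cont: "continuous_on (cball 0 r) f"
    and bound: "\<And>z. z \<in> cball 0 r \<Longrightarrow> cmod (f z) \<le> B" and "0 < r" "cmod z \<le> r / 2"
    and odd: "f (- z) = - f z"
  shows "cmod (f z - deriv f 0 * z) \<le> 2 * B * (cmod z / r) ^ 3"
    and "cmod (f z - (deriv f 0 * z + (deriv ^^ 3) f 0 / 6 * z ^ 3)) \<le> 2 * B * (cmod z / r) ^ 5"
proof -
  have half: "cmod (f z - (p z - p (- z)) / 2) \<le> e"
    if "cmod (f z - p z) \<le> e" "cmod (f (- z) - p (- z)) \<le> e" for p :: "complex \<Rightarrow> complex" and e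
  proof -
    have eq: "f z - (p z - p (- z)) / 2 = ((f z - p z) - (f (- z) - p (- z))) / 2"
      by (simp add: odd field_simps)
    have "cmod ((f z - p z) - (f (- z) - p (- z))) \<le> e + e"
      using norm_triangle_ineq4 that by (smt (verit))
    then show ?thesis unfolding eq by (simp add: norm_divide)
  qed
  note rem = holomorphic_taylor_remainder[OF holo cont bound \<open>0 < r\<close>]
  have z: "cmod z \<le> r / 2" "cmod (- z) \<le> r / 2" using assms by auto
  define c where "c k = (deriv ^^ k) f 0 / fact k" for k
  have c: "c 1 = deriv f 0" "c 3 = (deriv ^^ 3) f 0 / 6" by (simp_all add: c_def fact_numeral)
  have "((\<Sum>k<3. c k * z ^ k) - (\<Sum>k<3. c k * (- z) ^ k)) / 2 = c 1 * z"
    by (simp add: numeral_3_eq_3)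
  then show "cmod (f z - deriv f 0 * z) \<le> 2 * B * (cmod z / r) ^ 3"
    using half[of "\<lambda>z. \<Sum>k<3. c k * z ^ k" "2 * B * (cmod z / r) ^ 3"] rem[of z 3, OF _ z(1)] rem[of "- z" 3, OF _ z(2)]
    by (simp only: c_def[symmetric] norm_minus_cancel c)
  have "((\<Sum>k<5. c k * z ^ k) - (\<Sum>k<5. c k * (- z) ^ k)) / 2 = c 1 * z + c 3 * z ^ 3"
    by (simp add: eval_nat_numeral field_simps)
  then show "cmod (f z - (deriv f 0 * z + (deriv ^^ 3) f 0 / 6 * z ^ 3)) \<le> 2 * B * (cmod z / r) ^ 5"
    using half[of "\<lambda>z. \<Sum>k<5. c k * z ^ k" "2 * B * (cmod z / r) ^ 5"] rem[of z 5, OF _ z(1)] rem[of "- z" 5, OF _ z(2)]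
    by (simp only: c_def[symmetric] norm_minus_cancel c)
qed

lemma tanh_complex_of_real: "tanh (complex_of_real x) = of_real (tanh x)"
  unfolding tanh_altdef of_real_minus[symmetric] exp_of_real by simp

text \<open>
  The left-hand side is cubic near 0 and linear at infinity, as is the right-hand side. Comparison of the
  derivatives reduces the claim to \<open>tanh\<^sup>2 y \<ge> y\<^sup>2 / (1 + y\<^sup>2)\<close>, which follows from \<open>sinh y \<ge> y\<close>.
\<close>

lemma x_minus_tanh_ge:
  fixes x :: real
  assumes "x \<ge> 0"
  shows "x ^ 3 / (3 * (1 + x\<^sup>2)) \<le> x - tanh x"
proof -
  define g where "g x = x - tanh x - x ^ 3 / (3 * (1 + x\<^sup>2))" for x :: real
  have "g 0 \<le> g x"
  proof (rule DERIV_nonneg_imp_nondecreasing[OF assms])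
    fix y :: real assume "0 \<le> y" "y \<le> x"
    have p: "1 + y\<^sup>2 > 0" by (simp add: add_pos_nonneg)
    have "(g has_real_derivative (1 - (1 - (tanh y)\<^sup>2) - (3 * y\<^sup>2 * (3 * (1 + y\<^sup>2)) - y ^ 3 * (3 * (2 * y))) / (3 * (1 + y\<^sup>2))\<^sup>2)) (at y)"
      unfolding g_def using p
      by (auto intro!: derivative_eq_intros simp: power2_eq_square)
    moreover have "y\<^sup>2 / (1 + y\<^sup>2) \<le> (tanh y)\<^sup>2"
    proof -
      have "y \<le> sinh y"
      proof -
        have "\<exists>d. ((\<lambda>y. sinh y - y) has_real_derivative d) (at x) \<and> 0 \<le> d" for x :: real
          by (intro exI[of _ "cosh x - 1"] conjI) (auto intro!: derivative_eq_intros simp: cosh_real_ge_1)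
        then show ?thesis
          using DERIV_nonneg_imp_nondecreasing[of 0 y "\<lambda>y. sinh y - y"] \<open>0 \<le> y\<close> by auto
      qed
      then have "y\<^sup>2 \<le> (sinh y)\<^sup>2" using \<open>0 \<le> y\<close> by (intro power_mono) auto
      moreover have "(cosh y)\<^sup>2 = 1 + (sinh y)\<^sup>2" by (simp add: cosh_square_eq)
      ultimately show ?thesis
        unfolding tanh_def power_divide using p by (simp add: frac_le_eq divide_simps) (simp add: algebra_simps add_pos_nonneg)
    qed
    moreover have "(3 * y\<^sup>2 * (3 * (1 + y\<^sup>2)) - y ^ 3 * (3 * (2 * y))) / (3 * (1 + y\<^sup>2))\<^sup>2 \<le> y\<^sup>2 / (1 + y\<^sup>2)"
    proof -
      have "(3 * y\<^sup>2 * (3 * (1 + y\<^sup>2)) - y ^ 3 * (3 * (2 * y))) \<le> y\<^sup>2 * (9 * (1 + y\<^sup>2))"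
      proof -
        have "0 \<le> y ^ 3 * (3 * (2 * y))" using \<open>0 \<le> y\<close> by simp
        moreover have "3 * y\<^sup>2 * (3 * (1 + y\<^sup>2)) = y\<^sup>2 * (9 * (1 + y\<^sup>2))" by (simp add: algebra_simps)
        ultimately show ?thesis by linarith
      qed
      then have "(3 * y\<^sup>2 * (3 * (1 + y\<^sup>2)) - y ^ 3 * (3 * (2 * y))) / (3 * (1 + y\<^sup>2))\<^sup>2 \<le> y\<^sup>2 * (9 * (1 + y\<^sup>2)) / (3 * (1 + y\<^sup>2))\<^sup>2"
        by (intro divide_right_mono) auto
      also have "\<dots> = y\<^sup>2 / (1 + y\<^sup>2)"
      proof -
        have "y\<^sup>2 * (9 * c) / (3 * c)\<^sup>2 = y\<^sup>2 / c" if "c > 0" for c :: real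
          using that by (simp add: power2_eq_square)
        then show ?thesis using p by blast
      qed
      finally show ?thesis .
    qed
    ultimately show "\<exists>d. (g has_real_derivative d) (at y) \<and> 0 \<le> d"
      by (intro exI conjI) (assumption, linarith)
  qed
  then show ?thesis by (simp add: g_def)
qed

text \<open>
  Analyticity on a disc turns the uniform closeness of \<open>f\<close> to \<open>tanh\<close> into closeness of the derivatives at 0. Thus
  \<open>f - tanh\<close> minus its linear part is at most a small multiple of \<open>x\<^sup>3\<close> near 0, and trivially at most a small multiple
  of \<open>x\<close> away from 0, so half of the gap between \<open>tanh x\<close> and \<open>x\<close> absorbs it. The coefficient \<open>- 4 * \<kappa>\<close> is the cubic
  Taylor coefficient of \<open>f\<close>; for \<open>f = tanh\<close> one has \<open>\<kappa> = 1 / 12\<close>.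
\<close>

lemma near_tanh_bounds:
  fixes f :: "complex \<Rightarrow> complex" and m :: "real \<Rightarrow> real"
  assumes "open S" "cball 0 (1 / 2) \<subseteq> S" "f holomorphic_on S"
    and odd: "\<And>z. z \<in> cball 0 (1 / 2) \<Longrightarrow> f (- z) = - f z"
    and le1: "\<And>z. z \<in> cball 0 (1 / 2) \<Longrightarrow> cmod (f z) \<le> 1"
    and near: "\<And>z. z \<in> cball 0 (1 / 2) \<Longrightarrow> cmod (f z - tanh z) \<le> 1 / 700"
    and near_real: "\<And>x. \<bar>m x - tanh x\<bar> \<le> 1 / 700"
    and m: "\<And>x. f (of_real x) = of_real (m x)"
  obtains \<kappa> where "1 / 32 \<le> \<kappa>" "\<kappa> \<le> 2" "1 / 2 \<le> Re (deriv f 0)"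
    "\<And>x. \<bar>x\<bar> \<le> 1 / 4 \<Longrightarrow> \<bar>m x - Re (deriv f 0) * x + 4 * \<kappa> * x ^ 3\<bar> \<le> 64 * \<bar>x\<bar> ^ 5"
    "\<And>x. 0 \<le> x \<Longrightarrow> m x - Re (deriv f 0) * x \<le> - (x ^ 3 / (6 * (1 + x\<^sup>2)))"
proof -
  define a where "a = Re (deriv f 0)"
  define \<kappa> where "\<kappa> = - Re ((deriv ^^ 3) f 0) / 24"
  define D where "D = (\<lambda>z. f z - tanh z)"
  have ball: "ball (0 :: complex) (1 / 2) \<subseteq> S" using assms(2) ball_subset_cball by blast
  have f_holo: "f holomorphic_on ball 0 (1 / 2)" "continuous_on (cball 0 (1 / 2)) f"
    using assms(2,3) ball holomorphic_on_subset holomorphic_on_imp_continuous_on by blast+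
  have cosh_nz: "cosh z \<noteq> 0" if "z \<in> cball 0 (1 / 2)" for z :: complex
  proof
    assume "cosh z = 0"
    then have "exp (2 * z) = -1" by (simp add: cosh_zero_iff exp_double)
    moreover have "Re (exp (2 * z)) \<ge> 0"
      using that abs_Im_le_cmod[of z] by (intro Re_exp_strip) auto
    ultimately show False by simp
  qed
  have tanh_holo: "(tanh :: complex \<Rightarrow> complex) holomorphic_on cball 0 (1 / 2)"
    unfolding holomorphic_on_def field_differentiable_def
    using cosh_nz by (auto intro!: derivative_eq_intros exI)
  have D_holo: "D holomorphic_on ball 0 (1 / 2)" "continuous_on (cball 0 (1 / 2)) D"
    unfolding D_def
    by (intro holomorphic_on_diff f_holo holomorphic_on_subset[OF tanh_holo ball_subset_cball])
       (intro continuous_on_diff f_holo holomorphic_on_imp_continuous_on[OF tanh_holo])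
  have D_near: "cmod (D z) \<le> 1 / 700" if "z \<in> cball 0 (1 / 2)" for z
    unfolding D_def by (rule near[OF that])
  have D_odd: "D (- z) = - D z" if "z \<in> cball 0 (1 / 2)" for z
    using odd[OF that] by (simp add: D_def)
  have "(f has_field_derivative deriv f 0) (at 0)"
    using f_holo(1) by (intro holomorphic_derivI[of f "ball 0 (1 / 2)"]) auto
  then have "(D has_field_derivative (deriv f 0 - 1)) (at 0)"
    unfolding D_def by (auto intro!: derivative_eq_intros)
  then have D': "deriv D 0 = deriv f 0 - 1" by (rule DERIV_imp_deriv)
  have "cmod ((deriv ^^ 1) D 0) \<le> fact 1 * (1 / 700) / (1 / 2) ^ 1"
    by (rule Cauchy_inequality[OF D_holo], simp, rule D_near, simp)
  then have D'_le: "cmod (deriv f 0 - 1) \<le> 1 / 350" by (simp add: D')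
  then have a: "\<bar>a - 1\<bar> \<le> 1 / 350"
    using abs_Re_le_cmod[of "deriv f 0 - 1"] by (simp add: a_def)
  have "cmod ((deriv ^^ 3) f 0) \<le> fact 3 * 1 / (1 / 2) ^ 3"
    by (rule Cauchy_inequality[OF f_holo]) (auto simp: le1)
  then have \<kappa>2: "\<kappa> \<le> 2"
    using abs_Re_le_cmod[of "(deriv ^^ 3) f 0"] by (simp add: \<kappa>_def fact_numeral power3_eq_cube)
  have expand: "\<bar>m x - a * x + 4 * \<kappa> * x ^ 3\<bar> \<le> 64 * \<bar>x\<bar> ^ 5" if x: "\<bar>x\<bar> \<le> 1 / 4" for x
  proof -
    have "cmod (f x - (deriv f 0 * x + (deriv ^^ 3) f 0 / 6 * x ^ 3)) \<le> 2 * 1 * (cmod x / (1 / 2)) ^ 5"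
      unfolding of_real_power using x by (intro odd_holomorphic_taylor[OF f_holo le1] odd) auto
    moreover have "Re (f x - (deriv f 0 * x + (deriv ^^ 3) f 0 / 6 * x ^ 3)) = m x - a * x + 4 * \<kappa> * x ^ 3"
      by (simp add: m a_def \<kappa>_def flip: of_real_power)
    ultimately show ?thesis
      using abs_Re_le_cmod[of "f x - (deriv f 0 * x + (deriv ^^ 3) f 0 / 6 * x ^ 3)"]
      by (simp add: power_divide field_simps)
  qed
  have dominated: "m x - a * x \<le> - (x ^ 3 / (6 * (1 + x\<^sup>2)))" if x: "0 \<le> x" for x
  proof -
    define y where "y = x ^ 3 / (6 * (1 + x\<^sup>2))"
    have p: "1 + x\<^sup>2 > 0" by (simp add: add_pos_nonneg)
    have "(m x - tanh x) - (a - 1) * x \<le> y"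
    proof (cases "x \<le> 1 / 4")
      case True
      have "cmod (D x - deriv D 0 * x) \<le> 2 * (1 / 700) * (cmod x / (1 / 2)) ^ 3"
        using x True by (intro odd_holomorphic_taylor(1)[OF D_holo D_near] D_odd) auto
      moreover have "Re (D x - deriv D 0 * x) = (m x - tanh x) - (a - 1) * x"
        unfolding D' by (simp add: D_def m a_def tanh_complex_of_real)
      ultimately have "(m x - tanh x) - (a - 1) * x \<le> (16 / 700) * x ^ 3"
        using complex_Re_le_cmod[of "D x - deriv D 0 * x"] x by (simp add: power_divide field_simps)
      also have "\<dots> \<le> y"
      proof -
        have "x\<^sup>2 \<le> 1" using True x by (simp add: power_le_one)
        then have "(16 / 700) * (6 * (1 + x\<^sup>2)) \<le> 1" by simp
        then have "x ^ 3 * ((16 / 700) * (6 * (1 + x\<^sup>2))) \<le> x ^ 3 * 1"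
          using x by (intro mult_left_mono) auto
        then show ?thesis using p by (simp add: y_def pos_le_divide_eq algebra_simps)
      qed
      finally show ?thesis .
    next
      case False
      have "- (a - 1) * x \<le> 1 / 350 * x" using a x by (intro mult_right_mono; linarith)
      moreover have "m x - tanh x \<le> 1 / 700" using near_real[of x] by linarith
      ultimately have "(m x - tanh x) - (a - 1) * x \<le> 1 / 700 + 1 / 350 * x" by (simp add: algebra_simps)
      also have "\<dots> \<le> 6 / 700 * x" using False by simp
      also have "\<dots> \<le> y"
      proof -
        have "(1 / 4)\<^sup>2 \<le> x\<^sup>2" using False by (intro power_mono) auto
        then have "36 / 700 * (1 + x\<^sup>2) \<le> x\<^sup>2" by (simp add: power2_eq_square)
        then have "x * (36 / 700 * (1 + x\<^sup>2)) \<le> x * x\<^sup>2" using x by (intro mult_left_mono)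
        then have "6 / 700 * x * (6 * (1 + x\<^sup>2)) \<le> x ^ 3" by (simp add: power3_eq_cube power2_eq_square algebra_simps)
        then show ?thesis using p by (simp add: y_def pos_le_divide_eq)
      qed
      finally show ?thesis .
    qed
    moreover have "2 * y \<le> x - tanh x"
    proof -
      have "2 * (x ^ 3 / (6 * c)) = x ^ 3 / (3 * c)" for c :: real by simp
      then show ?thesis using x_minus_tanh_ge[OF x] unfolding y_def by metis
    qed
    ultimately show ?thesis unfolding y_def[symmetric] by (simp add: algebra_simps)
  qed
  \<comment> \<open>The expansion and the global bound are only compatible at the small point 1/50 if the cubic coefficient is negative enough.\<close>
  have "1 / 32 \<le> \<kappa>"
    using abs_le_D2[OF expand[of "1 / 50"]] dominated[of "1 / 50"] by (simp add: power_divide)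
  moreover have "1 / 2 \<le> a" using a by linarith
  ultimately show ?thesis using that[OF _ \<kappa>2 _ expand[unfolded a_def] dominated[unfolded a_def]] by (simp add: a_def)
qed

text \<open>
  The bounds for \<open>g\<close> are integrated. The primitive of \<open>x\<^sup>3 / (1 + x\<^sup>2)\<close> contains a logarithm; the simpler function
  \<open>x\<^sup>4 / (1 + x\<^sup>2)\<close> suffices, since its derivative is at most \<open>4 * x\<^sup>3 / (1 + x\<^sup>2)\<close> for \<open>x \<ge> 0\<close>.
\<close>

lemma integrate_quartic_bounds:
  fixes G g :: "real \<Rightarrow> real" and N \<kappa> :: real
  assumes G: "\<And>x. (G has_real_derivative N * g x) (at x)" "G 0 = 0" "\<And>x. G (- x) = G x" and "0 \<le> N"
    and g1: "\<And>x. \<bar>x\<bar> \<le> 1 / 4 \<Longrightarrow> \<bar>g x + 4 * \<kappa> * x ^ 3\<bar> \<le> 64 * \<bar>x\<bar> ^ 5"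
    and g2: "\<And>x. 0 \<le> x \<Longrightarrow> g x \<le> - (x ^ 3 / (6 * (1 + x\<^sup>2)))"
  shows "\<bar>x\<bar> \<le> 1 / 4 \<Longrightarrow> \<bar>G x + N * \<kappa> * x ^ 4\<bar> \<le> 64 * N * \<bar>x\<bar> ^ 6"
    and "G x \<le> - (N / 24 * (x ^ 4 / (1 + x\<^sup>2)))"
proof -
  show "\<bar>G x + N * \<kappa> * x ^ 4\<bar> \<le> 64 * N * \<bar>x\<bar> ^ 6" if x: "\<bar>x\<bar> \<le> 1 / 4"
  proof -
    define H where "H x = G x + N * \<kappa> * x ^ 4" for x
    have H': "(H has_real_derivative N * (g y + 4 * \<kappa> * y ^ 3)) (at y)" for y
      unfolding H_def by (auto intro!: derivative_eq_intros G(1) simp: algebra_simps)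
    have "norm (H x - H 0) \<le> (N * (64 * \<bar>x\<bar> ^ 5)) * norm (x - 0)"
    proof (rule field_differentiable_bound[where S = "cball 0 \<bar>x\<bar>"])
      fix y :: real assume "y \<in> cball 0 \<bar>x\<bar>"
      then have y: "\<bar>y\<bar> \<le> \<bar>x\<bar>" by simp
      show "(H has_field_derivative N * (g y + 4 * \<kappa> * y ^ 3)) (at y within cball 0 \<bar>x\<bar>)"
        using H' by (rule has_field_derivative_at_within)
      have "\<bar>g y + 4 * \<kappa> * y ^ 3\<bar> \<le> 64 * \<bar>y\<bar> ^ 5" using y x by (intro g1) auto
      also have "\<dots> \<le> 64 * \<bar>x\<bar> ^ 5" using y by (intro mult_left_mono power_mono) auto
      finally show "norm (N * (g y + 4 * \<kappa> * y ^ 3)) \<le> N * (64 * \<bar>x\<bar> ^ 5)"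
        using \<open>0 \<le> N\<close> by (simp add: abs_mult mult_left_mono)
    qed auto
    then show ?thesis by (simp add: H_def G(2) eval_nat_numeral mult_ac)
  qed
  have pos: "G x \<le> - (N / 24 * (x ^ 4 / (1 + x\<^sup>2)))" if x: "0 \<le> x" for x
  proof -
    define H where "H x = G x + N / 24 * (x ^ 4 / (1 + x\<^sup>2))" for x
    have "H x \<le> H 0"
    proof (rule DERIV_nonpos_imp_nonincreasing[OF x])
      fix y assume "0 \<le> y" "y \<le> x"
      have p: "1 + y\<^sup>2 > 0" by (simp add: add_pos_nonneg)
      have "((\<lambda>x. x ^ 4 / (1 + x\<^sup>2)) has_real_derivative ((4 * y ^ 3 * (1 + y\<^sup>2) - y ^ 4 * (2 * y)) / (1 + y\<^sup>2)\<^sup>2)) (at y)"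
        using p by (auto intro!: derivative_eq_intros simp: power2_eq_square)
      then have "(H has_real_derivative N * g y + N / 24 * ((4 * y ^ 3 * (1 + y\<^sup>2) - y ^ 4 * (2 * y)) / (1 + y\<^sup>2)\<^sup>2)) (at y)"
        unfolding H_def by (intro derivative_intros G(1) DERIV_cmult)
      define t where "t = y ^ 3 / (1 + y\<^sup>2)"
      define q where "q = (4 * y ^ 3 * (1 + y\<^sup>2) - y ^ 4 * (2 * y)) / (1 + y\<^sup>2)\<^sup>2"
      have "q \<le> 4 * t"
      proof -
        have "q \<le> 4 * y ^ 3 * (1 + y\<^sup>2) / (1 + y\<^sup>2)\<^sup>2"
          unfolding q_def using \<open>0 \<le> y\<close> by (intro divide_right_mono) auto
        also have "\<dots> = 4 * t" using p by (simp add: power2_eq_square t_def)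
        finally show ?thesis .
      qed
      moreover have "g y \<le> - (t / 6)" using g2[OF \<open>0 \<le> y\<close>] by (simp add: t_def mult.commute)
      ultimately have "g y + 1 / 24 * q \<le> 0"
        by linarith
      then have "N * (g y + 1 / 24 * q) \<le> 0"
        using \<open>0 \<le> N\<close> by (simp add: mult_le_0_iff)
      then have "N * g y + N / 24 * q \<le> 0"
        by (simp add: distrib_left)
      with \<open>(H has_real_derivative _) (at y)\<close>[folded q_def]
      show "\<exists>d. (H has_real_derivative d) (at y) \<and> d \<le> 0" by blast
    qed
    then show ?thesis by (simp add: H_def G(2))
  qed
  show "G x \<le> - (N / 24 * (x ^ 4 / (1 + x\<^sup>2)))"
    using pos[of x] pos[of "- x"] G(3)[of x] by (cases "0 \<le> x") auto
qed

section \<open>The cumulant generating function of the magnetization\<close>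

context ferromagnet begin

text \<open>
  The derivative of the cumulant generating function of \<open>Y\<close> is the sum of the mean spins in a uniform field. Divided
  by \<open>N\<close> it is an average of functions close to \<open>tanh\<close>, hence itself close to \<open>tanh\<close> with a bound that does not
  depend on \<open>V\<close>; and it is odd by the flip symmetry. The second moment \<open>s2\<close> is \<open>N\<close> times the derivative of this
  average at 0, so that subtracting \<open>s2 * x\<^sup>2 / 2\<close> removes exactly the linear term of the average.
\<close>

proposition log_laplace_quartic:
  fixes V :: "'v set" and w Y :: "('v \<Rightarrow> real) \<Rightarrow> real" and N W s2 :: real and G :: "real \<Rightarrow> real"
  assumes fin: "finite V" and ne: "V \<noteq> {}"
    and w_def: "\<And>\<sigma>. w \<sigma> = exp (pair_energy J V \<sigma>)" and Y_def: "\<And>\<sigma>. Y \<sigma> = (\<Sum>v\<in>V. \<sigma> v)"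
    and N_def: "N = real (card V)" and W_def: "W = (\<Sum>\<sigma>\<in>spin_configs V. w \<sigma>)"
    and s2_def: "s2 = (\<Sum>\<sigma>\<in>spin_configs V. w \<sigma> * (Y \<sigma>)\<^sup>2) / W"
    and G_def: "\<And>x. G x = ln ((\<Sum>\<sigma>\<in>spin_configs V. w \<sigma> * exp (x * Y \<sigma>)) / W) - s2 * x\<^sup>2 / 2"
  shows "\<exists>\<kappa>. 1 / 32 \<le> \<kappa> \<and> \<kappa> \<le> 2 \<and> N / 2 \<le> s2 \<and>
    (\<forall>x. \<bar>x\<bar> \<le> 1 / 4 \<longrightarrow> \<bar>G x + N * \<kappa> * x ^ 4\<bar> \<le> 64 * N * \<bar>x\<bar> ^ 6) \<and>
    (\<forall>x. G x \<le> - (N / 24 * (x ^ 4 / (1 + x\<^sup>2))))"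
proof -
  define \<Omega> where "\<Omega> = spin_configs V"
  have N: "N > 0" using fin ne by (simp add: N_def card_gt_0_iff)
  have fin\<Omega>: "finite \<Omega>" "\<Omega> \<noteq> {}"
    using fin by (simp_all add: \<Omega>_def finite_spin_configs spin_configs_nonempty)
  define R where "R x = (\<Sum>\<sigma>\<in>\<Omega>. w \<sigma> * exp (x * Y \<sigma>))" for x
  define R' where "R' x = (\<Sum>\<sigma>\<in>\<Omega>. w \<sigma> * exp (x * Y \<sigma>) * Y \<sigma>)" for x
  have R_pos: "R x > 0" for x
    unfolding R_def by (intro sum_pos fin\<Omega>) (simp add: w_def)
  have R0: "R 0 = W" by (simp add: R_def W_def \<Omega>_def)
  have W: "W > 0" using R_pos[of 0] R0 by simp
  have R_deriv: "(R has_real_derivative R' x) (at x)" for x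
    unfolding R_def R'_def by (auto intro!: derivative_eq_intros simp: mult_ac)
  define Zc where "Zc z = (\<Sum>\<sigma>\<in>\<Omega>. of_real (w \<sigma>) * exp (z * of_real (Y \<sigma>)))" for z :: complex
  define Zc' where "Zc' z = (\<Sum>\<sigma>\<in>\<Omega>. of_real (w \<sigma>) * exp (z * of_real (Y \<sigma>)) * of_real (Y \<sigma>))" for z :: complex
  have weight: "weight J V (\<lambda>_. z) \<sigma> = of_real (w \<sigma>) * exp (z * of_real (Y \<sigma>))" for z \<sigma>
    by (simp add: weight_def w_def Y_def exp_add sum_distrib_left exp_of_real)
  have Zc: "Zc z = Z V (\<lambda>_. z)" for z
    by (simp add: Zc_def partition_function_def weight \<Omega>_def)
  have Zc_deriv: "(Zc has_field_derivative Zc' z) (at z)" for z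
    unfolding Zc_def Zc'_def by (auto intro!: derivative_eq_intros simp: mult_ac)
  have Zc'_deriv: "(Zc' has_field_derivative
      (\<Sum>\<sigma>\<in>\<Omega>. of_real (w \<sigma>) * exp (z * of_real (Y \<sigma>)) * of_real (Y \<sigma>) * of_real (Y \<sigma>))) (at z)" for z
    unfolding Zc'_def by (auto intro!: derivative_eq_intros simp: mult_ac)
  define f where "f z = Zc' z / (of_real N * Zc z)" for z
  define m where "m x = R' x / (N * R x)" for x
  have f_real: "f (of_real x) = of_real (m x)" for x
    unfolding f_def m_def Zc_def Zc'_def R_def R'_def
    by (simp add: exp_of_real[symmetric])
  have flip: "Y (\<lambda>v\<in>V. - \<sigma> v) = - Y \<sigma>" "w (\<lambda>v\<in>V. - \<sigma> v) = w \<sigma>" for \<sigma>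
    by (simp_all add: Y_def w_def pair_energy_flip sum_negf)
  have Zc_neg: "Zc (- z) = Zc z" for z
    unfolding Zc_def \<Omega>_def by (subst sum_spin_configs_flip[symmetric]) (simp add: flip)
  have Zc'_neg: "Zc' (- z) = - Zc' z" for z
    unfolding Zc'_def \<Omega>_def by (subst sum_spin_configs_flip[symmetric]) (simp add: flip sum_negf)
  have R_neg: "R (- x) = R x" for x
    unfolding R_def \<Omega>_def by (subst sum_spin_configs_flip[symmetric]) (simp add: flip)
  have strip: "strip (\<lambda>_. z)" if "\<bar>Im z\<bar> \<le> 1 / 2" for z
    using that by (simp add: strip_def)
  have Zc_nz: "Zc z \<noteq> 0" if "\<bar>Im z\<bar> \<le> 1 / 2" for z
    unfolding Zc by (rule partition_function_nonzero[OF fin strip[OF that]])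
  have f_mean: "f z = (\<Sum>v\<in>V. spin_mean V (\<lambda>_. z) v) / of_real N" for z
  proof -
    have "Zc' z = (\<Sum>\<sigma>\<in>\<Omega>. \<Sum>v\<in>V. weight J V (\<lambda>_. z) \<sigma> * of_real (\<sigma> v))"
      unfolding Zc'_def weight by (simp add: Y_def sum_distrib_left)
    also have "\<dots> = (\<Sum>v\<in>V. \<Sum>\<sigma>\<in>\<Omega>. weight J V (\<lambda>_. z) \<sigma> * of_real (\<sigma> v))"
      by (rule sum.swap)
    finally show ?thesis
      by (simp add: f_def spin_mean_def Zc \<Omega>_def sum_divide_distrib mult.commute)
  qed
  have avg: "cmod ((\<Sum>v\<in>V. c v) / of_real N) \<le> e" if "\<And>v. v \<in> V \<Longrightarrow> cmod (c v) \<le> e" for c :: "'v \<Rightarrow> complex" and e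
  proof -
    have "cmod (\<Sum>v\<in>V. c v) \<le> N * e" using sum_norm_bound[of V c e] that by (simp add: N_def)
    then show ?thesis using N by (simp add: norm_divide divide_le_eq mult.commute)
  qed
  have f_near: "cmod (f z - tanh z) \<le> 1 / 700" "cmod (f z) \<le> 1" if "\<bar>Im z\<bar> \<le> 1 / 2" for z
  proof -
    have "f z - tanh z = (\<Sum>v\<in>V. spin_mean V (\<lambda>_. z) v - tanh z) / of_real N"
      using N by (simp add: f_mean sum_subtractf N_def diff_divide_distrib)
    also have "cmod \<dots> \<le> 8 * K"
      by (rule avg) (rule spin_mean_near_tanh(1)[OF fin strip[OF that], simplified])
    finally show "cmod (f z - tanh z) \<le> 1 / 700" using K_small by linarith
    show "cmod (f z) \<le> 1"
      unfolding f_mean by (intro avg spin_mean_near_tanh(2) fin strip that)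
  qed
  define S where "S = {z. Zc z \<noteq> 0}"
  have "continuous_on UNIV Zc"
    using DERIV_isCont[OF Zc_deriv] by (intro continuous_at_imp_continuous_on) blast
  then have "open S"
    unfolding S_def by (intro open_Collect_neq continuous_on_const)
  moreover have "cball 0 (1 / 2) \<subseteq> S"
  proof
    fix z :: complex assume "z \<in> cball 0 (1 / 2)"
    then have "\<bar>Im z\<bar> \<le> 1 / 2" using abs_Im_le_cmod[of z] by simp
    then show "z \<in> S" using Zc_nz by (simp add: S_def)
  qed
  moreover have "f holomorphic_on S"
  proof -
    have "Zc holomorphic_on S" "Zc' holomorphic_on S"
      unfolding holomorphic_on_def field_differentiable_def
      using has_field_derivative_at_within[OF Zc_deriv] has_field_derivative_at_within[OF Zc'_deriv] by blast+
    then show ?thesis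
      unfolding f_def using N by (intro holomorphic_intros) (auto simp: S_def)
  qed
  moreover have "f (- z) = - f z" for z by (simp add: f_def Zc_neg Zc'_neg)
  moreover have "cmod (f z - tanh z) \<le> 1 / 700" "cmod (f z) \<le> 1" if "z \<in> cball 0 (1 / 2)" for z
    using that abs_Im_le_cmod[of z] f_near[of z] by simp_all
  moreover have "\<bar>m x - tanh x\<bar> \<le> 1 / 700" for x
    using f_near(1)[of "of_real x"]
    unfolding f_real tanh_complex_of_real of_real_diff[symmetric] norm_of_real by simp
  ultimately obtain \<kappa> where \<kappa>: "1 / 32 \<le> \<kappa>" "\<kappa> \<le> 2" "1 / 2 \<le> Re (deriv f 0)"
    "\<And>x. \<bar>x\<bar> \<le> 1 / 4 \<Longrightarrow> \<bar>m x - Re (deriv f 0) * x + 4 * \<kappa> * x ^ 3\<bar> \<le> 64 * \<bar>x\<bar> ^ 5"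
    "\<And>x. 0 \<le> x \<Longrightarrow> m x - Re (deriv f 0) * x \<le> - (x ^ 3 / (6 * (1 + x\<^sup>2)))"
    using near_tanh_bounds[of S f m] f_real by metis
  have "Zc' 0 = 0" using Zc'_neg[of 0] by simp
  moreover have "Zc 0 = of_real W" by (simp add: Zc_def W_def \<Omega>_def)
  ultimately have "(f has_field_derivative of_real (s2 / N)) (at 0)"
    unfolding f_def using N W Zc'_deriv[of 0]
    by (auto intro!: derivative_eq_intros Zc_deriv Zc'_deriv simp: s2_def \<Omega>_def power2_eq_square mult.assoc)
  then have a: "Re (deriv f 0) = s2 / N" by (simp add: DERIV_imp_deriv)
  have G_eq: "G x = ln (R x / W) - s2 * x\<^sup>2 / 2" for x by (simp add: G_def R_def \<Omega>_def)
  have G_eq': "G = (\<lambda>x. ln (R x / W) - s2 * x\<^sup>2 / 2)" using G_eq by (rule ext)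
  have G_deriv: "(G has_real_derivative N * (m x - Re (deriv f 0) * x)) (at x)" for x
    unfolding G_eq' a using N W R_pos[of x]
    by (auto intro!: derivative_eq_intros R_deriv simp: m_def field_simps)
  have "N / 2 \<le> s2" using \<kappa>(3) N unfolding a by (simp add: field_simps)
  moreover have "G 0 = 0" using W by (simp add: G_eq R0)
  moreover have "G (- x) = G x" for x by (simp add: G_eq R_neg)
  moreover note integrate_quartic_bounds[OF G_deriv _ _ _ \<kappa>(4,5)]
  ultimately show ?thesis using \<kappa>(1,2) N by (intro exI[of _ \<kappa>]) simp
qed

end

section \<open>The Hubbard--Stratonovich transformation\<close>

text \<open>
  Completing the square. The formula allows \<open>exp (w\<^sup>2 / 2)\<close> to be replaced by the integral of an exponential that is
  linear in \<open>w\<close>.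
\<close>

lemma gaussian_tilt:
  "exp (- u\<^sup>2 / 2) * exp (u * w) = sqrt (2 * pi) * exp (w\<^sup>2 / 2) * normal_density w 1 u"
proof -
  have "- u\<^sup>2 / 2 + u * w = w\<^sup>2 / 2 + - (u - w)\<^sup>2 / 2"
    by (simp add: power2_eq_square field_simps)
  then have "exp (- u\<^sup>2 / 2) * exp (u * w) = exp (w\<^sup>2 / 2) * exp (- (u - w)\<^sup>2 / 2)"
    by (simp only: exp_add[symmetric])
  then show ?thesis by (simp add: normal_density_def)
qed

lemma gaussian_tilt_sum:
  "exp (- u\<^sup>2 / 2) * (\<Sum>\<sigma>\<in>\<Omega>. w \<sigma> * exp (u * X \<sigma>)) =
   (\<Sum>\<sigma>\<in>\<Omega>. w \<sigma> * sqrt (2 * pi) * exp ((X \<sigma>)\<^sup>2 / 2) * normal_density (X \<sigma>) 1 u)"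
  unfolding sum_distrib_left mult.left_commute[of "exp (- u\<^sup>2 / 2)"] gaussian_tilt
  by (simp add: mult.assoc)

lemma normal_density_fourier:
  "has_bochner_integral lborel (\<lambda>u. normal_density w 1 u *\<^sub>R iexp (\<theta> * u))
     (iexp (\<theta> * w) * of_real (exp (- \<theta>\<^sup>2 / 2)))"
proof -
  have int: "integrable lborel (\<lambda>u. std_normal_density u *\<^sub>R iexp (\<theta> * u))"
    by (rule Bochner_Integration.integrable_bound[OF integrable_normal_density[of 1 0]]) auto
  have "char std_normal_distribution \<theta> = (\<integral>u. std_normal_density u *\<^sub>R iexp (\<theta> * u) \<partial>lborel)"
    unfolding char_def by (subst integral_density) (auto simp: normal_density_nonneg)
  then have "has_bochner_integral lborel (\<lambda>u. std_normal_density u *\<^sub>R iexp (\<theta> * u)) (of_real (exp (- \<theta>\<^sup>2 / 2)))"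
    using int by (simp add: has_bochner_integral_iff char_std_normal_distribution)
  then have "has_bochner_integral lborel (\<lambda>u. std_normal_density (- w + 1 * u) *\<^sub>R iexp (\<theta> * (- w + 1 * u)))
      (of_real (exp (- \<theta>\<^sup>2 / 2)) /\<^sub>R \<bar>1\<bar>)"
    by (subst (asm) lborel_has_bochner_integral_real_affine_iff[where c = 1 and t = "- w"]) simp_all
  then have "has_bochner_integral lborel
      (\<lambda>u. iexp (\<theta> * w) * (std_normal_density (- w + 1 * u) *\<^sub>R iexp (\<theta> * (- w + 1 * u))))
      (iexp (\<theta> * w) * (of_real (exp (- \<theta>\<^sup>2 / 2)) /\<^sub>R \<bar>1\<bar>))"
    by (rule has_bochner_integral_mult_right)
  moreover have "iexp (\<theta> * w) * (std_normal_density (- w + 1 * u) *\<^sub>R iexp (\<theta> * (- w + 1 * u))) =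
      normal_density w 1 u *\<^sub>R iexp (\<theta> * u)" for u
    by (simp add: normal_density_def scaleR_conv_of_real exp_add[symmetric] right_diff_distrib algebra_simps)
  ultimately show ?thesis by simp
qed

lemma normal_density_second_moment:
  "has_bochner_integral lborel (\<lambda>u. normal_density w 1 u * u\<^sup>2) (1 + w\<^sup>2)"
proof -
  have "has_bochner_integral lborel
     (\<lambda>u. normal_density w 1 u * (u - w) ^ (2 * 1) + 2 * w * (normal_density w 1 u * (u - w) ^ (2 * 0 + 1))
        + w\<^sup>2 * (normal_density w 1 u * (u - w) ^ (2 * 0)))
     (fact (2 * 1) / ((2 / 1\<^sup>2) ^ 1 * fact 1) + 2 * w * 0 + w\<^sup>2 * (fact (2 * 0) / ((2 / 1\<^sup>2) ^ 0 * fact 0)))"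
    by (intro has_bochner_integral_add has_bochner_integral_mult_right normal_moment_even normal_moment_odd) auto
  moreover have "normal_density w 1 u * (u - w) ^ (2 * 1) + 2 * w * (normal_density w 1 u * (u - w) ^ (2 * 0 + 1))
        + w\<^sup>2 * (normal_density w 1 u * (u - w) ^ (2 * 0)) = normal_density w 1 u * u\<^sup>2" for u
    by (simp add: power2_eq_square algebra_simps)
  ultimately show ?thesis by simp
qed

text \<open>
  If \<open>X\<close> has the law with weights \<open>w\<close> tilted by \<open>exp (X\<^sup>2 / 2)\<close>, then \<open>X\<close> plus an independent standard Gaussian variable
  has the density \<open>exp (- u\<^sup>2 / 2)\<close> times the Laplace transform of \<open>w\<close>, up to normalization. The formula expresses
  this for characteristic functions, and \<open>hubbard_stratonovich_moment\<close> for second moments, where the noise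
  contributes the summand 1.
\<close>

lemma hubbard_stratonovich_char:
  assumes "finite \<Omega>"
  shows "has_bochner_integral lborel
     (\<lambda>u. of_real (exp (- u\<^sup>2 / 2) * (\<Sum>\<sigma>\<in>\<Omega>. w \<sigma> * exp (u * X \<sigma>))) * iexp (\<theta> * u))
     (of_real (sqrt (2 * pi) * exp (- \<theta>\<^sup>2 / 2)) *
       (\<Sum>\<sigma>\<in>\<Omega>. of_real (w \<sigma> * exp ((X \<sigma>)\<^sup>2 / 2)) * iexp (\<theta> * X \<sigma>)))"
proof -
  have "has_bochner_integral lborel
     (\<lambda>u. \<Sum>\<sigma>\<in>\<Omega>. of_real (w \<sigma> * sqrt (2 * pi) * exp ((X \<sigma>)\<^sup>2 / 2)) *
         (normal_density (X \<sigma>) 1 u *\<^sub>R iexp (\<theta> * u)))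
     (\<Sum>\<sigma>\<in>\<Omega>. of_real (w \<sigma> * sqrt (2 * pi) * exp ((X \<sigma>)\<^sup>2 / 2)) *
        (iexp (\<theta> * X \<sigma>) * of_real (exp (- \<theta>\<^sup>2 / 2))))"
    by (intro has_bochner_integral_sum has_bochner_integral_mult_right normal_density_fourier)
  moreover have "of_real (exp (- u\<^sup>2 / 2) * (\<Sum>\<sigma>\<in>\<Omega>. w \<sigma> * exp (u * X \<sigma>))) * iexp (\<theta> * u) =
     (\<Sum>\<sigma>\<in>\<Omega>. of_real (w \<sigma> * sqrt (2 * pi) * exp ((X \<sigma>)\<^sup>2 / 2)) *
         (normal_density (X \<sigma>) 1 u *\<^sub>R iexp (\<theta> * u)))" for u
    unfolding gaussian_tilt_sum by (simp add: sum_distrib_left scaleR_conv_of_real mult_ac)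
  ultimately show ?thesis
    by (simp add: sum_distrib_left mult_ac)
qed

lemma hubbard_stratonovich_moment:
  assumes "finite \<Omega>"
  shows "has_bochner_integral lborel
     (\<lambda>u. u\<^sup>2 * (exp (- u\<^sup>2 / 2) * (\<Sum>\<sigma>\<in>\<Omega>. w \<sigma> * exp (u * X \<sigma>))))
     (sqrt (2 * pi) * (\<Sum>\<sigma>\<in>\<Omega>. w \<sigma> * exp ((X \<sigma>)\<^sup>2 / 2) * (1 + (X \<sigma>)\<^sup>2)))"
proof -
  have "has_bochner_integral lborel
     (\<lambda>u. \<Sum>\<sigma>\<in>\<Omega>. w \<sigma> * sqrt (2 * pi) * exp ((X \<sigma>)\<^sup>2 / 2) * (normal_density (X \<sigma>) 1 u * u\<^sup>2))
     (\<Sum>\<sigma>\<in>\<Omega>. w \<sigma> * sqrt (2 * pi) * exp ((X \<sigma>)\<^sup>2 / 2) * (1 + (X \<sigma>)\<^sup>2))"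
    by (intro has_bochner_integral_sum has_bochner_integral_mult_right normal_density_second_moment)
  moreover have "u\<^sup>2 * (exp (- u\<^sup>2 / 2) * (\<Sum>\<sigma>\<in>\<Omega>. w \<sigma> * exp (u * X \<sigma>))) =
     (\<Sum>\<sigma>\<in>\<Omega>. w \<sigma> * sqrt (2 * pi) * exp ((X \<sigma>)\<^sup>2 / 2) * (normal_density (X \<sigma>) 1 u * u\<^sup>2))" for u
    unfolding gaussian_tilt_sum by (simp add: sum_distrib_left mult_ac)
  ultimately show ?thesis
    by (simp add: sum_distrib_left mult_ac)
qed

section \<open>Moments of the quartic weight\<close>

text \<open>
  On the positive half-line the substitution \<open>u = x\<^sup>4\<close> leads to the integral that defines the gamma function.
\<close>

lemma quartic_moment:
  assumes "even k"
  shows "has_bochner_integral lborel (\<lambda>x :: real. x ^ k * exp (- (x ^ 4))) (Gamma ((real k + 1) / 4) / 2)"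
proof -
  define f where "f u = u powr ((real k + 1) / 4 - 1) * exp (- u)" for u :: real
  have f0: "f absolutely_integrable_on {0<..} \<and> integral {0<..} f = Gamma ((real k + 1) / 4)"
  proof -
    have "(f has_integral Gamma ((real k + 1) / 4)) {0..}"
      using Gamma_integral_real[of "(real k + 1) / 4"] by (simp add: f_def[abs_def] exp_minus field_simps)
    then have "(f has_integral Gamma ((real k + 1) / 4)) {0<..}"
      by (subst has_integral_spike_set_eq[of "{0<..}" "{0..}"])
         (auto intro: negligible_subset[of "{0::real}"])
    then show ?thesis
      by (auto simp: has_integral_iff f_def intro!: nonnegative_absolutely_integrable_1)
  qed
  have image: "(\<lambda>x :: real. x ^ 4) ` {0<..} = {0<..}"
  proof (intro equalityI subsetI)
    fix y :: real assume "y \<in> {0<..}"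
    then show "y \<in> (\<lambda>x. x ^ 4) ` {0<..}" by (intro image_eqI[of _ _ "root 4 y"]) auto
  qed auto
  have leb: "(\<lambda>x. \<bar>4 * x ^ 3\<bar> * f (x ^ 4)) absolutely_integrable_on {0<..} \<and>
        integral {0<..} (\<lambda>x. \<bar>4 * x ^ 3\<bar> * f (x ^ 4)) = Gamma ((real k + 1) / 4)"
  proof (rule has_absolute_integral_change_of_variables_1'[where g = "\<lambda>x. x ^ 4" and g' = "\<lambda>x. 4 * x ^ 3"
        and f = f and S = "{0<..}", THEN iffD2])
    show "((\<lambda>x. x ^ 4) has_field_derivative 4 * x ^ 3) (at x within {0<..})" for x :: real
      by (auto intro!: derivative_eq_intros)
    show "inj_on (\<lambda>x :: real. x ^ 4) {0<..}"
      by (auto intro!: inj_onI simp: power_eq_iff_eq_base)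
  qed (auto simp: image f0)
  have subst_eq: "x ^ 3 * f (x ^ 4) = x ^ k * exp (- (x ^ 4))" if "x > 0" for x
  proof -
    have "(x ^ 4) powr ((real k + 1) / 4 - 1) = x powr (4 * ((real k + 1) / 4 - 1))"
    proof -
      have "x ^ 4 = x powr 4" using that powr_realpow[of x 4] by simp
      then show ?thesis by (simp only: powr_powr)
    qed
    also have "4 * ((real k + 1) / 4 - 1) = real k - 3" by simp
    also have "x powr (real k - 3) = x ^ k / x ^ 3"
      using that by (simp add: powr_diff powr_realpow)
    finally show ?thesis using that by (simp add: f_def)
  qed
  define h where "h x = indicator {0<..} x *\<^sub>R (\<bar>4 * x ^ 3\<bar> * f (x ^ 4))" for x :: real
  have h_meas: "h \<in> borel_measurable lborel" unfolding h_def f_def by measurable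
  have "integrable (completion lborel) h"
    using leb by (simp add: set_integrable_def h_def[abs_def])
  then have "integrable lborel h" using integrable_completion[OF h_meas] by simp
  moreover have "integral\<^sup>L lborel h = Gamma ((real k + 1) / 4)"
    using leb set_lebesgue_integral_eq_integral[of "{0<..}" "\<lambda>x. \<bar>4 * x ^ 3\<bar> * f (x ^ 4)"]
      integral_completion[OF h_meas]
    by (simp add: set_lebesgue_integral_def h_def[abs_def])
  ultimately have "has_bochner_integral lborel h (Gamma ((real k + 1) / 4))"
    by (simp add: has_bochner_integral_iff)
  then have "has_bochner_integral lborel (\<lambda>x. 1 / 4 * h x) (1 / 4 * Gamma ((real k + 1) / 4))"
    by (rule has_bochner_integral_mult_right)
  then have "has_bochner_integral lborel (\<lambda>x. indicator {0..} x *\<^sub>R (x ^ k * exp (- (x ^ 4)))) (1 / 4 * Gamma ((real k + 1) / 4))"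
    by (subst (asm) has_bochner_integral_discrete_difference[where X = "{0}"])
       (auto simp: h_def indicator_def subst_eq)
  then have "has_bochner_integral lborel (\<lambda>x. x ^ k * exp (- (x ^ 4))) (2 *\<^sub>R (1 / 4 * Gamma ((real k + 1) / 4)))"
    using assms by (intro has_bochner_integral_even_function) auto
  then show ?thesis by simp
qed


section \<open>Convergence for a family with quartic free energy\<close>

text \<open>
  The number 288 is twice the variance \<open>12\<^sup>2\<close> of a normal distribution; the envelope is used in \<open>\<psi>_bound\<close>.
\<close>

lemma integrable_gaussian_envelope:
  "integrable lborel (\<lambda>y :: real. exp ((1 - y\<^sup>2) / 288) * (1 + y\<^sup>2))"
proof -
  define c where "c = sqrt (2 * pi * 144) * exp (1 / 288)"
  have "integrable lborel (\<lambda>y. c * normal_density 0 12 y + c * (normal_density 0 12 y * (y - 0) ^ 2))"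
    by (intro Bochner_Integration.integrable_add integrable_mult_right integrable_normal_moment integrable_normal_density) simp_all
  then have "integrable lborel (\<lambda>y. sqrt (2 * pi * 144) * exp (1 / 288) * normal_density 0 12 y * (1 + y\<^sup>2))"
    by (simp add: c_def distrib_left mult.assoc)
  moreover have "sqrt (2 * pi * 144) * exp (1 / 288) * normal_density 0 12 y = exp ((1 - y\<^sup>2) / 288)" for y
  proof -
    have "(1 - y\<^sup>2) / 288 = 1 / 288 + - (y - 0)\<^sup>2 / (2 * 12\<^sup>2)" by (simp add: diff_divide_distrib)
    then have "exp ((1 - y\<^sup>2) / 288) = exp (1 / 288) * exp (- (y - 0)\<^sup>2 / (2 * 12\<^sup>2))"
      by (simp only: exp_add)
    then show ?thesis by (simp add: normal_density_def)
  qed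
  ultimately show ?thesis by simp
qed

lemma Gamma_quarter_nonzero: "Gamma (1 / 4 :: real) \<noteq> 0"
  by (rule less_imp_neq[symmetric, OF Gamma_real_pos]) simp

text \<open>
  By \<open>quartic_moment\<close> this is the standard deviation of the density proportional to \<open>exp (- y\<^sup>4)\<close>.
\<close>

definition quartic_scale :: real where
  "quartic_scale = sqrt (Gamma (3 / 4) / Gamma (1 / 4))"

lemma quartic_scale_pos: "quartic_scale > 0"
  using Gamma_real_pos[of "3 / 4"] Gamma_real_pos[of "1 / 4"] by (simp add: quartic_scale_def)

text \<open>
  A sequence of finite random variables \<open>X n\<close> whose cumulant generating functions have the form established in
  \<open>log_laplace_quartic\<close>, with bounds that are uniform in \<open>n\<close>. In the application \<open>s2 n\<close> is the second moment
  of \<open>X n\<close>.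
\<close>

locale quartic_family =
  fixes \<Omega> :: "nat \<Rightarrow> 'a set" and w X :: "nat \<Rightarrow> 'a \<Rightarrow> real" and N \<kappa> s2 :: "nat \<Rightarrow> real"
    and G :: "nat \<Rightarrow> real \<Rightarrow> real"
  assumes fin: "finite (\<Omega> n)" "\<Omega> n \<noteq> {}" and w_pos: "0 < w n \<sigma>"
    and G_def: "G n x = ln (\<Sum>\<sigma>\<in>\<Omega> n. w n \<sigma> * exp (x * X n \<sigma>)) - s2 n * x\<^sup>2 / 2"
    and N: "filterlim N at_top sequentially" "1 \<le> N n" and \<kappa>: "1 / 32 \<le> \<kappa> n" "\<kappa> n \<le> 2"
    and s2: "N n / 2 \<le> s2 n"
    and expansion: "\<bar>x\<bar> \<le> 1 / 4 \<Longrightarrow> \<bar>G n x + N n * \<kappa> n * x ^ 4\<bar> \<le> 64 * N n * \<bar>x\<bar> ^ 6"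
    and domination: "G n x \<le> - (N n / 24 * (x ^ 4 / (1 + x\<^sup>2)))"
begin

text \<open>
  With \<open>u = sd n * scale n * y\<close> the density \<open>exp (G n (u / sd n))\<close> of the tilted and smoothed variable becomes \<open>\<psi> n y\<close>,
  up to normalization. The choice of \<open>scale n\<close> makes the quartic term of its exponent equal to \<open>- y\<^sup>4\<close>.
\<close>

definition scale where "scale n = 1 / sqrt (sqrt (N n * \<kappa> n))"
definition sd where "sd n = sqrt (s2 n)"
definition \<psi> where "\<psi> n y = exp (G n (scale n * y))"

definition tilt where "tilt n \<sigma> = w n \<sigma> * exp ((X n \<sigma>)\<^sup>2 / (2 * s2 n))"

lemma s2_pos: "s2 n > 0" and sd_pos: "sd n > 0" and sd_sq: "(sd n)\<^sup>2 = s2 n"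
  using s2[of n] N(2)[of n] by (auto simp: sd_def)

lemma scale_pos: "scale n > 0" and scale_pow4: "N n * \<kappa> n * scale n ^ 4 = 1"
proof -
  have p: "N n * \<kappa> n > 0" using \<kappa>(1)[of n] N(2)[of n] by simp
  then show "scale n > 0" by (simp add: scale_def)
  have "scale n ^ 4 = 1 / ((sqrt (sqrt (N n * \<kappa> n)))\<^sup>2)\<^sup>2"
    by (simp add: scale_def power_divide flip: power_mult)
  then show "N n * \<kappa> n * scale n ^ 4 = 1" using p by (auto simp: zero_less_mult_iff)
qed

lemma N\<kappa>_at_top: "filterlim (\<lambda>n. N n * \<kappa> n) at_top sequentially"
proof (rule filterlim_at_top_mono)
  show "filterlim (\<lambda>n. N n * (1 / 32)) at_top sequentially"
    by (rule filterlim_at_top_mult_tendsto_pos[OF tendsto_const _ N(1)]) simp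
  show "\<forall>\<^sub>F n in sequentially. N n * (1 / 32) \<le> N n * \<kappa> n"
    using \<kappa>(1) N(2) by (intro always_eventually allI mult_left_mono) (auto intro: order_trans[OF zero_le_one])
qed

lemma scale_tendsto_0: "scale \<longlonglongrightarrow> 0"
proof -
  have "filterlim (\<lambda>n. sqrt (sqrt (N n * \<kappa> n))) at_top sequentially"
    by (intro filterlim_compose[OF sqrt_at_top] N\<kappa>_at_top)
  then have "(\<lambda>n. 1 / sqrt (sqrt (N n * \<kappa> n))) \<longlonglongrightarrow> 0"
    by (rule tendsto_divide_0[OF tendsto_const filterlim_at_top_imp_at_infinity])
  then show ?thesis by (simp add: scale_def[abs_def])
qed

text \<open>
  In the variable \<open>y\<close> the added Gaussian noise has variance \<open>1 / (sd n * scale n)\<^sup>2\<close>. Since \<open>s2 n\<close> is at least of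
  order \<open>N n\<close> and \<open>scale n ^ 4\<close> is of order \<open>1 / N n\<close>, it is at most of order \<open>N n\<close> to the power \<open>- 1 / 2\<close>.
\<close>

lemma noise_tendsto_0: "(\<lambda>n. 1 / (sd n * scale n)\<^sup>2) \<longlonglongrightarrow> 0"
proof (rule tendsto_sandwich[OF _ _ tendsto_const])
  show "\<forall>\<^sub>F n in sequentially. 0 \<le> 1 / (sd n * scale n)\<^sup>2" by simp
  show "\<forall>\<^sub>F n in sequentially. 1 / (sd n * scale n)\<^sup>2 \<le> 4 * (scale n)\<^sup>2"
  proof (intro always_eventually allI)
    fix n
    have "1 = N n * \<kappa> n * scale n ^ 4" by (simp add: scale_pow4)
    also have "\<dots> \<le> 2 * s2 n * 2 * scale n ^ 4"
      using s2[of n] \<kappa>[of n] N(2)[of n] by (intro mult_right_mono mult_mono) auto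
    also have "\<dots> = 4 * (scale n)\<^sup>2 * (sd n * scale n)\<^sup>2"
      unfolding power_mult_distrib sd_sq by (simp add: power2_eq_square power4_eq_xxxx)
    finally show "1 / (sd n * scale n)\<^sup>2 \<le> 4 * (scale n)\<^sup>2"
      using sd_pos[of n] scale_pos[of n] by (simp add: divide_le_eq)
  qed
  show "(\<lambda>n. 4 * (scale n)\<^sup>2) \<longlonglongrightarrow> 0"
    using tendsto_mult[OF tendsto_const[of 4] tendsto_power[OF scale_tendsto_0, of 2]] by simp
qed

lemma laplace_pos: "(\<Sum>\<sigma>\<in>\<Omega> n. w n \<sigma> * exp (x * X n \<sigma>)) > 0"
  by (intro sum_pos fin) (simp add: w_pos)

lemma exp_G: "exp (G n x) = (\<Sum>\<sigma>\<in>\<Omega> n. w n \<sigma> * exp (x * X n \<sigma>)) * exp (- s2 n * x\<^sup>2 / 2)"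
proof -
  have "G n x = ln (\<Sum>\<sigma>\<in>\<Omega> n. w n \<sigma> * exp (x * X n \<sigma>)) + - s2 n * x\<^sup>2 / 2" by (simp add: G_def)
  then show ?thesis using laplace_pos[of n x] by (simp only: exp_add exp_ln)
qed

lemma \<psi>_measurable [measurable]: "\<psi> n \<in> borel_measurable borel"
  unfolding \<psi>_def[abs_def] exp_G by measurable

lemma \<psi>_eq: "\<psi> n y = exp (- (sd n * scale n * y)\<^sup>2 / 2) *
    (\<Sum>\<sigma>\<in>\<Omega> n. w n \<sigma> * exp (sd n * scale n * y * (X n \<sigma> / sd n)))"
proof -
  have "sd n * scale n * y * (X n \<sigma> / sd n) = scale n * y * X n \<sigma>" for \<sigma>
    using sd_pos[of n] by simp
  then show ?thesis by (simp add: \<psi>_def exp_G power_mult_distrib sd_sq mult.commute)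
qed

text \<open>
  The global bound on \<open>G n\<close> becomes a negative multiple of \<open>y\<^sup>4 / (1 + (scale n * y)\<^sup>2)\<close>, where \<open>scale n\<close> is bounded; and
  \<open>y\<^sup>4 / (1 + y\<^sup>2) \<ge> y\<^sup>2 - 1\<close>.
\<close>

lemma \<psi>_bound: "\<psi> n y \<le> exp ((1 - y\<^sup>2) / 288)"
proof -
  have pos: "N n > 0" "\<kappa> n > 0" using N(2)[of n] \<kappa>(1)[of n] by auto
  have p: "1 + y\<^sup>2 > 0" for y :: real by (simp add: add_pos_nonneg)
  have "(scale n)\<^sup>2 \<le> 6"
  proof -
    have "scale n ^ 4 = 1 / (N n * \<kappa> n)" using scale_pow4[of n] pos by (simp add: field_simps)
    also have "\<dots> \<le> 1 / (1 * (1 / 32))"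
      using N(2)[of n] \<kappa>(1)[of n] by (intro divide_left_mono mult_mono) auto
    finally have "((scale n)\<^sup>2)\<^sup>2 \<le> 6\<^sup>2" by (simp flip: power_mult)
    then show ?thesis by (rule power2_le_imp_le) simp
  qed
  then have "(scale n)\<^sup>2 * y\<^sup>2 \<le> 6 * y\<^sup>2" by (rule mult_right_mono) simp
  then have le: "1 + (scale n * y)\<^sup>2 \<le> 6 * (1 + y\<^sup>2)" by (simp add: power_mult_distrib)
  have "y\<^sup>2 - 1 \<le> y ^ 4 / (1 + y\<^sup>2)"
    unfolding pos_le_divide_eq[OF p] by (simp add: algebra_simps power2_eq_square power4_eq_xxxx)
  then have "(y\<^sup>2 - 1) / 288 \<le> y ^ 4 / (1 + y\<^sup>2) / 288" by (rule divide_right_mono) simp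
  also have "\<dots> \<le> y ^ 4 / (1 + y\<^sup>2) / (144 * \<kappa> n)"
    using \<kappa>[of n] pos p[of y] by (intro divide_left_mono) auto
  also have "\<dots> = 1 / (24 * \<kappa> n) * (y ^ 4 / (6 * (1 + y\<^sup>2)))"
    by simp
  also have "\<dots> \<le> 1 / (24 * \<kappa> n) * (y ^ 4 / (1 + (scale n * y)\<^sup>2))"
    using le p[of "scale n * y"] p[of y] pos by (intro mult_left_mono divide_left_mono) auto
  also have "\<dots> = N n / 24 * ((scale n * y) ^ 4 / (1 + (scale n * y)\<^sup>2))"
  proof -
    have "N n * scale n ^ 4 = 1 / \<kappa> n" using scale_pow4[of n] pos by (simp add: field_simps)
    then show ?thesis by (simp add: power_mult_distrib mult.assoc[symmetric])
  qed
  finally have "G n (scale n * y) \<le> (1 - y\<^sup>2) / 288"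
    using domination[of n "scale n * y"] by (simp add: diff_divide_distrib)
  then show ?thesis by (simp add: \<psi>_def)
qed

text \<open>
  The remainder of order \<open>N n * (scale n * y) ^ 6\<close> tends to 0 because \<open>N n * scale n ^ 4\<close> is bounded and \<open>scale n\<close> tends
  to 0.
\<close>

lemma \<psi>_tendsto: "(\<lambda>n. \<psi> n y) \<longlonglongrightarrow> exp (- (y ^ 4))"
proof -
  have "(\<lambda>n. \<bar>scale n * y\<bar>) \<longlonglongrightarrow> 0"
    using tendsto_rabs[OF tendsto_mult_right[OF scale_tendsto_0, of y]] by simp
  then have ev: "\<forall>\<^sub>F n in sequentially. \<bar>scale n * y\<bar> < 1 / 4"
    by (rule order_tendstoD) simp
  have "(\<lambda>n. G n (scale n * y) + y ^ 4) \<longlonglongrightarrow> 0"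
  proof (rule tendsto_rabs_zero_cancel, rule tendsto_sandwich[OF _ _ tendsto_const])
    show "\<forall>\<^sub>F n in sequentially. 0 \<le> \<bar>G n (scale n * y) + y ^ 4\<bar>" by simp
    show "\<forall>\<^sub>F n in sequentially. \<bar>G n (scale n * y) + y ^ 4\<bar> \<le> 2048 * \<bar>y\<bar> ^ 6 * (scale n)\<^sup>2"
      using ev
    proof eventually_elim
      fix n assume "\<bar>scale n * y\<bar> < 1 / 4"
      then have "\<bar>G n (scale n * y) + N n * \<kappa> n * (scale n * y) ^ 4\<bar> \<le> 64 * N n * \<bar>scale n * y\<bar> ^ 6"
        by (intro expansion) simp
      also have "N n * \<kappa> n * (scale n * y) ^ 4 = y ^ 4"
        using scale_pow4[of n] by (simp add: power_mult_distrib mult.assoc[symmetric])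
      also have "64 * N n * \<bar>scale n * y\<bar> ^ 6 = 64 * (N n * scale n ^ 4) * (\<bar>y\<bar> ^ 6 * (scale n)\<^sup>2)"
        using scale_pos[of n] by (simp add: abs_mult power_mult_distrib mult_ac flip: power_add)
      also have "\<dots> \<le> 64 * 32 * (\<bar>y\<bar> ^ 6 * (scale n)\<^sup>2)"
      proof (intro mult_right_mono mult_left_mono)
        have "N n * scale n ^ 4 * (1 / 32) \<le> N n * scale n ^ 4 * \<kappa> n"
          using \<kappa>(1)[of n] N(2)[of n] scale_pos[of n] by (intro mult_left_mono) auto
        also have "\<dots> = 1" using scale_pow4[of n] by (simp add: mult_ac)
        finally show "N n * scale n ^ 4 \<le> 32" by simp
      qed auto
      finally show "\<bar>G n (scale n * y) + y ^ 4\<bar> \<le> 2048 * \<bar>y\<bar> ^ 6 * (scale n)\<^sup>2" by simp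
    qed
    show "(\<lambda>n. 2048 * \<bar>y\<bar> ^ 6 * (scale n)\<^sup>2) \<longlonglongrightarrow> 0"
      using tendsto_mult_left[OF tendsto_power[OF scale_tendsto_0, of 2], of "2048 * \<bar>y\<bar> ^ 6"] by simp
  qed
  then have "(\<lambda>n. (G n (scale n * y) + y ^ 4) - y ^ 4) \<longlonglongrightarrow> 0 - y ^ 4"
    by (intro tendsto_diff tendsto_const)
  then have "(\<lambda>n. G n (scale n * y)) \<longlonglongrightarrow> - (y ^ 4)" by simp
  then show ?thesis unfolding \<psi>_def by (rule tendsto_exp)
qed

lemma \<psi>_integral_tendsto:
  fixes g :: "nat \<Rightarrow> real \<Rightarrow> 'b :: {banach, second_countable_topology, real_normed_algebra_1}"
  assumes "\<And>n. g n \<in> borel_measurable borel" "g' \<in> borel_measurable borel"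
    and "\<And>n y. norm (g n y) \<le> 1 + y\<^sup>2" and "\<And>y. (\<lambda>n. g n y) \<longlonglongrightarrow> g' y"
  shows "(\<lambda>n. \<integral>y. \<psi> n y *\<^sub>R g n y \<partial>lborel) \<longlonglongrightarrow> (\<integral>y. exp (- (y ^ 4)) *\<^sub>R g' y \<partial>lborel)"
proof (rule integral_dominated_convergence[OF _ _ integrable_gaussian_envelope])
  show "AE y in lborel. (\<lambda>n. \<psi> n y *\<^sub>R g n y) \<longlonglongrightarrow> exp (- (y ^ 4)) *\<^sub>R g' y"
    by (intro AE_I2 tendsto_scaleR \<psi>_tendsto assms)
  show "AE y in lborel. norm (\<psi> n y *\<^sub>R g n y) \<le> exp ((1 - y\<^sup>2) / 288) * (1 + y\<^sup>2)" for n
  proof (intro AE_I2)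
    fix y :: real
    have "\<psi> n y \<ge> 0" by (simp add: \<psi>_def)
    then show "norm (\<psi> n y *\<^sub>R g n y) \<le> exp ((1 - y\<^sup>2) / 288) * (1 + y\<^sup>2)"
      using \<psi>_bound[of n y] assms(3)[of n y] by (simp add: mult_mono)
  qed
  show "(\<lambda>y. \<psi> n y *\<^sub>R g n y) \<in> borel_measurable lborel" for n
    using assms(1)[of n] by measurable
  show "(\<lambda>y. exp (- (y ^ 4)) *\<^sub>R g' y) \<in> borel_measurable lborel"
    using assms(2) by measurable
qed


text \<open>
  The second moment of \<open>X n\<close> under the tilted law. The number \<open>ratio n\<close> is its square root in the units of the
  variable \<open>y\<close>: one factor \<open>sd n\<close> belongs to the passage from \<open>X n\<close> to \<open>X n / sd n\<close>, the other one to the scaling of \<open>u\<close>.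
\<close>

definition second_moment where
  "second_moment n = (\<Sum>\<sigma>\<in>\<Omega> n. tilt n \<sigma> * (X n \<sigma>)\<^sup>2) / (\<Sum>\<sigma>\<in>\<Omega> n. tilt n \<sigma>)"

definition ratio where "ratio n = sqrt (second_moment n) / (sd n * (sd n * scale n))"

lemma tilt_sum_pos: "(\<Sum>\<sigma>\<in>\<Omega> n. tilt n \<sigma>) > 0"
  by (intro sum_pos fin) (simp add: tilt_def w_pos)

lemma tilt_eq: "w n \<sigma> * exp ((X n \<sigma> / sd n)\<^sup>2 / 2) = tilt n \<sigma>"
  by (simp add: tilt_def power_divide sd_sq)

lemma fourier_\<psi>:
  "of_real (sd n * scale n) * (\<integral>y. \<psi> n y *\<^sub>R iexp (\<theta> * (sd n * scale n * y)) \<partial>lborel) =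
   of_real (sqrt (2 * pi) * exp (- \<theta>\<^sup>2 / 2)) *
     (\<Sum>\<sigma>\<in>\<Omega> n. of_real (tilt n \<sigma>) * iexp (\<theta> * (X n \<sigma> / sd n)))"
proof -
  have "(\<integral>u. of_real (exp (- u\<^sup>2 / 2) * (\<Sum>\<sigma>\<in>\<Omega> n. w n \<sigma> * exp (u * (X n \<sigma> / sd n)))) * iexp (\<theta> * u) \<partial>lborel) =
    of_real (sqrt (2 * pi) * exp (- \<theta>\<^sup>2 / 2)) *
     (\<Sum>\<sigma>\<in>\<Omega> n. of_real (tilt n \<sigma>) * iexp (\<theta> * (X n \<sigma> / sd n)))"
    unfolding tilt_eq[symmetric]
    by (rule has_bochner_integral_integral_eq[OF hubbard_stratonovich_char[OF fin(1)]])
  then show ?thesis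
    using sd_pos[of n] scale_pos[of n]
    by (subst (asm) lborel_integral_real_affine[where c = "sd n * scale n" and t = 0])
       (simp_all add: \<psi>_eq scaleR_conv_of_real abs_mult)
qed

lemma mass_\<psi>:
  "sd n * scale n * (\<integral>y. \<psi> n y \<partial>lborel) = sqrt (2 * pi) * (\<Sum>\<sigma>\<in>\<Omega> n. tilt n \<sigma>)"
proof -
  have "of_real (sd n * scale n) * (\<integral>y. of_real (\<psi> n y) \<partial>lborel) = (of_real (sqrt (2 * pi) * (\<Sum>\<sigma>\<in>\<Omega> n. tilt n \<sigma>)) :: complex)"
    using fourier_\<psi>[of n 0] by (simp add: scaleR_conv_of_real)
  then have "complex_of_real (sd n * scale n * (\<integral>y. \<psi> n y \<partial>lborel)) = of_real (sqrt (2 * pi) * (\<Sum>\<sigma>\<in>\<Omega> n. tilt n \<sigma>))"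
    unfolding integral_complex_of_real of_real_mult[symmetric] .
  then show ?thesis unfolding of_real_eq_iff .
qed

lemma moment_\<psi>:
  "(sd n * scale n) ^ 3 * (\<integral>y. \<psi> n y * y\<^sup>2 \<partial>lborel) =
   sqrt (2 * pi) * (\<Sum>\<sigma>\<in>\<Omega> n. tilt n \<sigma> * (1 + (X n \<sigma>)\<^sup>2 / s2 n))"
proof -
  have "(\<integral>u. u\<^sup>2 * (exp (- u\<^sup>2 / 2) * (\<Sum>\<sigma>\<in>\<Omega> n. w n \<sigma> * exp (u * (X n \<sigma> / sd n)))) \<partial>lborel) =
     sqrt (2 * pi) * (\<Sum>\<sigma>\<in>\<Omega> n. tilt n \<sigma> * (1 + (X n \<sigma> / sd n)\<^sup>2))"
    unfolding tilt_eq[symmetric]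
    by (rule has_bochner_integral_integral_eq[OF hubbard_stratonovich_moment[OF fin(1)]])
  also have "(\<lambda>\<sigma>. (X n \<sigma> / sd n)\<^sup>2) = (\<lambda>\<sigma>. (X n \<sigma>)\<^sup>2 / s2 n)" by (simp add: power_divide sd_sq)
  finally have "sd n * scale n * (\<integral>y. (sd n * scale n * y)\<^sup>2 * \<psi> n y \<partial>lborel) =
     sqrt (2 * pi) * (\<Sum>\<sigma>\<in>\<Omega> n. tilt n \<sigma> * (1 + (X n \<sigma>)\<^sup>2 / s2 n))"
    using sd_pos[of n] scale_pos[of n]
    by (subst (asm) lborel_integral_real_affine[where c = "sd n * scale n" and t = 0])
       (simp_all add: \<psi>_eq abs_mult)
  moreover have "(\<integral>y. (sd n * scale n * y)\<^sup>2 * \<psi> n y \<partial>lborel) = (sd n * scale n)\<^sup>2 * (\<integral>y. \<psi> n y * y\<^sup>2 \<partial>lborel)"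
    by (simp add: power_mult_distrib mult_ac flip: integral_mult_right_zero)
  ultimately show ?thesis by (simp add: power3_eq_cube power2_eq_square mult_ac)
qed

lemma mass_pos: "(\<integral>y. \<psi> n y \<partial>lborel) > 0"
proof -
  have "0 < sd n * scale n * (\<integral>y. \<psi> n y \<partial>lborel)"
    unfolding mass_\<psi> using tilt_sum_pos by simp
  then show ?thesis by (rule zero_less_mult_pos) (intro mult_pos_pos sd_pos scale_pos)
qed

lemma second_moment_nonneg: "second_moment n \<ge> 0"
  unfolding second_moment_def using tilt_sum_pos[of n]
  by (intro divide_nonneg_pos sum_nonneg) (auto simp: tilt_def less_imp_le[OF w_pos])

lemma ratio_nonneg: "ratio n \<ge> 0"
  unfolding ratio_def
  by (intro divide_nonneg_pos real_sqrt_ge_zero second_moment_nonneg mult_pos_pos sd_pos scale_pos)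

text \<open>
  The variance of the smoothed variable is the sum of the variances of the tilted variable and of the noise.
\<close>

lemma ratio_sq: "(ratio n)\<^sup>2 = (\<integral>y. \<psi> n y * y\<^sup>2 \<partial>lborel) / (\<integral>y. \<psi> n y \<partial>lborel) - 1 / (sd n * scale n)\<^sup>2"
proof -
  define a I0 I2 T where "a = sd n * scale n" and "I0 = (\<integral>y. \<psi> n y \<partial>lborel)"
    and "I2 = (\<integral>y. \<psi> n y * y\<^sup>2 \<partial>lborel)" and "T = (\<Sum>\<sigma>\<in>\<Omega> n. tilt n \<sigma>)"
  have pos: "a > 0" "I0 > 0" "T > 0" "s2 n > 0"
    using sd_pos scale_pos mass_pos tilt_sum_pos s2_pos by (simp_all add: a_def I0_def T_def)
  have "(\<Sum>\<sigma>\<in>\<Omega> n. tilt n \<sigma> * (1 + (X n \<sigma>)\<^sup>2 / s2 n)) = T * (1 + second_moment n / s2 n)"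
  proof -
    define D where "D = (\<Sum>\<sigma>\<in>\<Omega> n. tilt n \<sigma> * (X n \<sigma>)\<^sup>2)"
    have "(\<Sum>\<sigma>\<in>\<Omega> n. tilt n \<sigma> * (1 + (X n \<sigma>)\<^sup>2 / s2 n)) = T + D / s2 n"
      by (simp add: T_def D_def distrib_left sum.distrib sum_divide_distrib)
    also have "\<dots> = T * (1 + second_moment n / s2 n)"
      using pos by (simp add: second_moment_def D_def[symmetric] T_def[symmetric] distrib_left)
    finally show ?thesis .
  qed
  then have "a ^ 3 * I2 = sqrt (2 * pi) * (T * (1 + second_moment n / s2 n))"
    using moment_\<psi>[of n] by (simp add: a_def I2_def)
  moreover have "a * I0 = sqrt (2 * pi) * T" using mass_\<psi>[of n] by (simp add: a_def I0_def T_def)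
  ultimately have "a ^ 3 * I2 = a * I0 * (1 + second_moment n / s2 n)" by simp
  then have "I2 / I0 = (1 + second_moment n / s2 n) / a\<^sup>2"
    using pos by (simp add: divide_simps power3_eq_cube power2_eq_square) (simp add: algebra_simps)
  moreover have "(ratio n)\<^sup>2 = second_moment n / s2 n / a\<^sup>2"
    using second_moment_nonneg[of n] by (simp add: ratio_def a_def power_mult_distrib power_divide sd_sq)
  ultimately show ?thesis
    unfolding a_def[symmetric] I0_def[symmetric] I2_def[symmetric] by (simp add: add_divide_distrib)
qed

lemma mass_tendsto: "(\<lambda>n. \<integral>y. \<psi> n y \<partial>lborel) \<longlonglongrightarrow> Gamma (1 / 4) / 2"
proof -
  have J: "(\<integral>y. exp (- (y ^ 4)) \<partial>lborel) = Gamma (1 / 4 :: real) / 2"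
    using has_bochner_integral_integral_eq[OF quartic_moment[of 0]] by simp
  have "(\<lambda>n. \<integral>y. \<psi> n y *\<^sub>R 1 \<partial>lborel) \<longlonglongrightarrow> (\<integral>y. exp (- (y ^ 4)) *\<^sub>R (1 :: real) \<partial>lborel)"
    by (rule \<psi>_integral_tendsto) auto
  then show ?thesis by (simp only: real_scaleR_def mult_1_right J)
qed

lemma ratio_tendsto: "ratio \<longlonglongrightarrow> quartic_scale"
proof -
  have "(\<lambda>n. \<integral>y. \<psi> n y * y\<^sup>2 \<partial>lborel) \<longlonglongrightarrow> Gamma (3 / 4) / 2"
    using \<psi>_integral_tendsto[of "\<lambda>_ y. y\<^sup>2" "\<lambda>y. y\<^sup>2"] has_bochner_integral_integral_eq[OF quartic_moment[of 2]]
    by (simp add: mult.commute)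
  then have "(\<lambda>n. (ratio n)\<^sup>2) \<longlonglongrightarrow> (Gamma (3 / 4) / 2) / (Gamma (1 / 4) / 2) - 0"
    unfolding ratio_sq
    by (intro tendsto_diff tendsto_divide mass_tendsto noise_tendsto_0) (auto simp: Gamma_quarter_nonzero)
  then have "(\<lambda>n. sqrt ((ratio n)\<^sup>2)) \<longlonglongrightarrow> quartic_scale"
    unfolding quartic_scale_def by (intro tendsto_real_sqrt) simp
  moreover have "sqrt ((ratio n)\<^sup>2) = ratio n" for n
    using ratio_nonneg[of n] by simp
  ultimately show ?thesis by simp
qed

text \<open>
  The characteristic function of the normalized tilted variable is that of the smoothed variable divided by that of
  the noise, and the latter tends to 1. Normalizing by the exact second moment only changes the frequency to
  \<open>\<theta> / ratio n\<close>, which converges; dominated convergence covers this dependence on \<open>n\<close>.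
\<close>

theorem char_tendsto:
  "(\<lambda>n. (\<Sum>\<sigma>\<in>\<Omega> n. of_real (tilt n \<sigma>) * iexp (\<theta> * (X n \<sigma> / sqrt (second_moment n)))) /
        of_real (\<Sum>\<sigma>\<in>\<Omega> n. tilt n \<sigma>))
   \<longlonglongrightarrow> (\<integral>y. exp (- (y ^ 4)) *\<^sub>R iexp (\<theta> * (y / quartic_scale)) \<partial>lborel) / of_real (Gamma (1 / 4) / 2)"
proof -
  define e where "e n = (\<theta> / ratio n)\<^sup>2 * (1 / (sd n * scale n)\<^sup>2) / 2" for n
  define F where "F n = (\<integral>y. \<psi> n y *\<^sub>R iexp (\<theta> * (y / ratio n)) \<partial>lborel)" for n
  have F: "F \<longlonglongrightarrow> (\<integral>y. exp (- (y ^ 4)) *\<^sub>R iexp (\<theta> * (y / quartic_scale)) \<partial>lborel)"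
    unfolding F_def
  proof (rule \<psi>_integral_tendsto)
    show "(\<lambda>n. iexp (\<theta> * (y / ratio n))) \<longlonglongrightarrow> iexp (\<theta> * (y / quartic_scale))" for y
      using quartic_scale_pos by (intro tendsto_intros ratio_tendsto) auto
  qed auto
  have e: "e \<longlonglongrightarrow> 0"
  proof -
    have "(\<lambda>n. (\<theta> / ratio n)\<^sup>2 * (1 / (sd n * scale n)\<^sup>2) / 2) \<longlonglongrightarrow> (\<theta> / quartic_scale)\<^sup>2 * 0 / 2"
      using quartic_scale_pos by (intro tendsto_intros ratio_tendsto noise_tendsto_0) auto
    then show ?thesis by (simp add: e_def[abs_def])
  qed
  have lim: "(\<lambda>n. of_real (exp (e n)) * F n / of_real (\<integral>y. \<psi> n y \<partial>lborel)) \<longlonglongrightarrow>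
      of_real (exp 0) * (\<integral>y. exp (- (y ^ 4)) *\<^sub>R iexp (\<theta> * (y / quartic_scale)) \<partial>lborel) / of_real (Gamma (1 / 4) / 2)"
    by (intro tendsto_divide tendsto_mult tendsto_of_real tendsto_exp e F mass_tendsto)
       (auto simp: Gamma_quarter_nonzero)
  have ev: "\<forall>\<^sub>F n in sequentially.
     of_real (exp (e n)) * F n / of_real (\<integral>y. \<psi> n y \<partial>lborel) =
     (\<Sum>\<sigma>\<in>\<Omega> n. of_real (tilt n \<sigma>) * iexp (\<theta> * (X n \<sigma> / sqrt (second_moment n)))) /
        of_real (\<Sum>\<sigma>\<in>\<Omega> n. tilt n \<sigma>)"
    using order_tendstoD(1)[OF ratio_tendsto quartic_scale_pos]
  proof eventually_elim
    fix n assume pos: "ratio n > 0"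
    define a where "a = sd n * scale n"
    have a: "a > 0" using sd_pos[of n] scale_pos[of n] by (simp add: a_def)
    define \<Theta> where "\<Theta> = \<theta> / (ratio n * a)"
    define S where "S = (\<Sum>\<sigma>\<in>\<Omega> n. of_real (tilt n \<sigma>) * iexp (\<theta> * (X n \<sigma> / sqrt (second_moment n))))"
    define T where "T = (\<Sum>\<sigma>\<in>\<Omega> n. tilt n \<sigma>)"
    have "ratio n * a * sd n = sqrt (second_moment n)"
      using sd_pos[of n] scale_pos[of n] by (simp add: ratio_def a_def)
    then have arg: "\<Theta> * (X n \<sigma> / sd n) = \<theta> * (X n \<sigma> / sqrt (second_moment n))" for \<sigma>
      by (simp add: \<Theta>_def flip: \<open>ratio n * a * sd n = _\<close>)
    have arg': "\<Theta> * (a * y) = \<theta> * (y / ratio n)" for y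
      using a by (simp add: \<Theta>_def)
    have exponent: "\<Theta>\<^sup>2 / 2 = e n"
      by (simp add: \<Theta>_def e_def a_def power_mult_distrib power_divide)
    have "of_real a * F n = of_real (sqrt (2 * pi) * exp (- (e n))) * S"
      using fourier_\<psi>[of n \<Theta>] unfolding a_def[symmetric] arg arg' F_def[symmetric] S_def[symmetric]
      by (simp add: exponent)
    then have "of_real (exp (e n)) * (of_real a * F n) = of_real (exp (e n) * (sqrt (2 * pi) * exp (- (e n)))) * S"
      by simp
    also have "exp (e n) * (sqrt (2 * pi) * exp (- (e n))) = sqrt (2 * pi)"
      by (simp add: exp_minus)
    finally have num: "of_real (exp (e n)) * F n = of_real (sqrt (2 * pi) / a) * S"
      using a by (simp add: field_simps)
    have "(\<integral>y. \<psi> n y \<partial>lborel) = sqrt (2 * pi) / a * T"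
      using mass_\<psi>[of n] a by (simp add: a_def[symmetric] T_def[symmetric] field_simps)
    then show "of_real (exp (e n)) * F n / of_real (\<integral>y. \<psi> n y \<partial>lborel) = S / of_real T"
      unfolding num using a by simp
  qed
  show ?thesis
    using Lim_transform_eventually[OF lim ev] by (simp only: exp_zero of_real_1 mult_1)
qed

end

section \<open>The nearest-neighbor coupling on boxes\<close>

lemma lattice_box_mono: "m \<le> n \<Longrightarrow> lattice_box d m \<subseteq> lattice_box d n"
  unfolding lattice_box_def by (intro PiE_mono) simp

lemma card_lattice_box: "card (lattice_box d n) = (2 * n + 1) ^ d"
proof -
  have "card {- int n..int n} = 2 * n + 1" unfolding card_atLeastAtMost_int by arith
  then show ?thesis by (simp add: lattice_box_def card_PiE)
qed

lemma nearest_neighbor_sym: "nearest_neighbor d u v = nearest_neighbor d v u"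
proof -
  have "(\<lambda>i. \<bar>u i - v i\<bar>) = (\<lambda>i. \<bar>v i - u i\<bar>)" by (intro ext abs_minus_commute)
  then show ?thesis by (simp only: nearest_neighbor_def)
qed

lemma nearest_neighbor_irrefl: "\<not> nearest_neighbor d u u"
  unfolding nearest_neighbor_def by simp

lemma nearest_neighbor_coord:
  assumes "nearest_neighbor d u v" "i < d"
  shows "\<bar>u i - v i\<bar> \<le> 1"
proof -
  have "\<bar>u i - v i\<bar> \<le> (\<Sum>i<d. \<bar>u i - v i\<bar>)"
    using assms(2) by (intro member_le_sum) auto
  then show ?thesis using assms(1) by (simp only: nearest_neighbor_def)
qed

text \<open>
  The crude bound by the number of points of the surrounding cube is enough here, because \<open>\<beta>\<^sub>1\<close> may be small.
\<close>

lemma card_neighbors_le: "card {v \<in> lattice_box d m. nearest_neighbor d u v} \<le> 3 ^ d"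
proof -
  have sub: "{v \<in> lattice_box d m. nearest_neighbor d u v} \<subseteq> (\<Pi>\<^sub>E i\<in>{..<d}. {u i - 1..u i + 1})"
  proof
    fix v assume "v \<in> {v \<in> lattice_box d m. nearest_neighbor d u v}"
    then have v: "v \<in> lattice_box d m" "nearest_neighbor d u v" by auto
    show "v \<in> (\<Pi>\<^sub>E i\<in>{..<d}. {u i - 1..u i + 1})"
    proof (rule PiE_I)
      fix i assume "i \<in> {..<d}"
      then show "v i \<in> {u i - 1..u i + 1}" using nearest_neighbor_coord[OF v(2), of i] by auto
    next
      fix i assume "i \<notin> {..<d}"
      then show "v i = undefined" by (rule PiE_arb[OF v(1)[unfolded lattice_box_def]])
    qed
  qed
  have "card {v \<in> lattice_box d m. nearest_neighbor d u v} \<le> card (\<Pi>\<^sub>E i\<in>{..<d}. {u i - 1..u i + 1})"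
    by (intro card_mono sub finite_PiE) auto
  also have "\<dots> = 3 ^ d" by (simp add: card_PiE)
  finally show ?thesis .
qed

lemma neighbor_in_next_box:
  assumes "v \<in> lattice_box d m" "nearest_neighbor d v u" "u \<in> lattice_box d n"
  shows "u \<in> lattice_box d (Suc m)"
  unfolding lattice_box_def
proof (rule PiE_I)
  fix i assume i: "i \<in> {..<d}"
  have "v i \<in> {- int m..int m}" by (rule PiE_mem[OF assms(1)[unfolded lattice_box_def] i])
  then show "u i \<in> {- int (Suc m)..int (Suc m)}"
    using nearest_neighbor_coord[OF assms(2), of i] i unfolding atLeastAtMost_iff lessThan_iff by linarith
next
  fix i assume "i \<notin> {..<d}"
  then show "u i = undefined" by (rule PiE_arb[OF assms(3)[unfolded lattice_box_def]])
qed

text \<open>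
  The relation \<open>nearest_neighbor\<close> only looks at the first \<open>d\<close> coordinates, so without the restriction to the box a
  point would have infinitely many neighbors among the functions of type \<^typ>\<open>nat \<Rightarrow> int\<close>.
\<close>

definition nn_coupling :: "nat \<Rightarrow> nat \<Rightarrow> real \<Rightarrow> (nat \<Rightarrow> int) \<Rightarrow> (nat \<Rightarrow> int) \<Rightarrow> real" where
  "nn_coupling d n \<beta> u v =
     (if u \<in> lattice_box d n \<and> v \<in> lattice_box d n \<and> nearest_neighbor d u v then \<beta> else 0)"

lemma ferromagnet_nn_coupling:
  assumes "0 \<le> \<beta>" "8000 * (3 ^ d * \<beta>) \<le> 1"
  shows "ferromagnet (nn_coupling d n \<beta>) (3 ^ d * \<beta>)"
proof
  fix V :: "(nat \<Rightarrow> int) set" and v assume V: "finite V"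
  have "(\<Sum>u\<in>V. nn_coupling d n \<beta> v u) \<le> (\<Sum>u\<in>V \<inter> {u \<in> lattice_box d n. nearest_neighbor d v u}. \<beta>)"
    using V assms(1) by (subst sum.inter_restrict) (auto intro!: sum_mono simp: nn_coupling_def)
  also have "\<dots> = real (card (V \<inter> {u \<in> lattice_box d n. nearest_neighbor d v u})) * \<beta>" by simp
  also have "\<dots> \<le> 3 ^ d * \<beta>"
  proof (rule mult_right_mono[OF _ assms(1)])
    have "card (V \<inter> {u \<in> lattice_box d n. nearest_neighbor d v u}) \<le> card {u \<in> lattice_box d n. nearest_neighbor d v u}"
      by (intro card_mono) (auto simp: finite_lattice_box)
    also have "\<dots> \<le> 3 ^ d" by (rule card_neighbors_le)
    finally show "real (card (V \<inter> {u \<in> lattice_box d n. nearest_neighbor d v u})) \<le> 3 ^ d"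
      using of_nat_mono by fastforce
  qed
  finally show "(\<Sum>u\<in>V. nn_coupling d n \<beta> v u) \<le> 3 ^ d * \<beta>" .
next
  show "nn_coupling d n \<beta> u v = nn_coupling d n \<beta> v u" for u v
    unfolding nn_coupling_def using nearest_neighbor_sym[of d u v] by auto
qed (use assms in \<open>auto simp: nn_coupling_def nearest_neighbor_irrefl\<close>)

text \<open>
  Each edge corresponds to two ordered pairs, which the factor 1/2 in \<open>pair_energy\<close> compensates.
\<close>

lemma pair_energy_nn_coupling:
  "pair_energy (nn_coupling d n \<beta>) (lattice_box d n) \<sigma> = \<beta> * interaction d n \<sigma>"
proof -
  let ?\<Lambda> = "lattice_box d n"
  define P where "P = {p \<in> ?\<Lambda> \<times> ?\<Lambda>. nearest_neighbor d (fst p) (snd p)}"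
  define e where "e p = {fst p, snd p}" for p :: "(nat \<Rightarrow> int) \<times> (nat \<Rightarrow> int)"
  have finP: "finite P" by (simp add: P_def finite_lattice_box)
  have edges: "edges d ?\<Lambda> = e ` P"
    by (force simp: edges_def P_def e_def image_iff)
  have "(\<Sum>u\<in>?\<Lambda>. \<Sum>v\<in>?\<Lambda>. nn_coupling d n \<beta> u v * \<sigma> u * \<sigma> v) =
        (\<Sum>p\<in>?\<Lambda> \<times> ?\<Lambda>. if nearest_neighbor d (fst p) (snd p) then \<beta> * (\<sigma> (fst p) * \<sigma> (snd p)) else 0)"
    unfolding sum.cartesian_product by (intro sum.cong) (auto simp: nn_coupling_def)
  also have "\<dots> = (\<Sum>p\<in>P. \<beta> * (\<sigma> (fst p) * \<sigma> (snd p)))"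
    unfolding P_def by (intro sum.inter_filter[symmetric]) (simp add: finite_lattice_box)
  also have "\<dots> = (\<Sum>p\<in>P. \<beta> * (\<Prod>u\<in>e p. \<sigma> u))"
  proof (intro sum.cong refl)
    fix p assume "p \<in> P"
    then have "fst p \<noteq> snd p" by (auto simp: P_def nearest_neighbor_irrefl)
    then show "\<beta> * (\<sigma> (fst p) * \<sigma> (snd p)) = \<beta> * (\<Prod>u\<in>e p. \<sigma> u)" by (simp add: e_def)
  qed
  also have "\<dots> = (\<Sum>b\<in>e ` P. \<Sum>p\<in>{p \<in> P. e p = b}. \<beta> * (\<Prod>u\<in>e p. \<sigma> u))"
    by (rule sum.image_gen[OF finP])
  also have "\<dots> = (\<Sum>b\<in>e ` P. 2 * (\<beta> * (\<Prod>u\<in>b. \<sigma> u)))"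
  proof (rule sum.cong)
    fix b assume "b \<in> e ` P"
    then obtain u v where b: "b = {u, v}" "(u, v) \<in> P" by (auto simp: e_def)
    then have "u \<noteq> v" "(v, u) \<in> P" by (auto simp: P_def nearest_neighbor_irrefl nearest_neighbor_sym)
    with b have "{p \<in> P. e p = b} = {(u, v), (v, u)}"
      by (auto simp: e_def doubleton_eq_iff)
    then show "(\<Sum>p\<in>{p \<in> P. e p = b}. \<beta> * (\<Prod>u\<in>e p. \<sigma> u)) = 2 * (\<beta> * (\<Prod>u\<in>b. \<sigma> u))"
      using \<open>u \<noteq> v\<close> b(1) by (simp add: e_def insert_commute)
  qed simp
  finally show ?thesis
    by (simp add: pair_energy_def interaction_def edges sum_distrib_left[symmetric])
qed

lemma integral_gibbs_measure_complex:
  fixes f :: "('v \<Rightarrow> real) \<Rightarrow> complex"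
  assumes "finite \<Lambda>"
  shows "(LINT \<sigma>|gibbs_measure \<Lambda> h. f \<sigma>) =
    (\<Sum>\<sigma>\<in>spin_configs \<Lambda>. of_real (exp (h \<sigma>)) * f \<sigma>) / of_real (\<Sum>\<tau>\<in>spin_configs \<Lambda>. exp (h \<tau>))"
  unfolding gibbs_measure_def
  using partition_function_pos[OF assms, of h] finite_spin_configs[OF assms]
  by (subst lebesgue_integral_point_measure_finite)
     (auto simp: sum_divide_distrib sum_nonneg scaleR_conv_of_real)

section \<open>Absence of spontaneous magnetization\<close>

text \<open>
  A plus boundary condition is a field on the sites of the box that have a neighbor outside, and \<open>spin_mean_decay\<close>
  bounds its effect at the centre.
\<close>

lemma spontaneous_magnetization_zero:
  assumes "0 \<le> \<beta>" "8000 * (3 ^ d * \<beta>) \<le> 1"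
  shows "spontaneous_magnetization d \<beta> = 0"
proof -
  define K where "K = 3 ^ d * \<beta>"
  have K: "0 \<le> K" "8000 * K \<le> 1" using assms by (simp_all add: K_def)
  have bound: "\<bar>LINT \<sigma>|ising_plus d n \<beta>. \<sigma> (\<lambda>i\<in>{..<d}. 0)\<bar> \<le> 14 * (16 * K) ^ n" for n
  proof -
    let ?\<Lambda> = "lattice_box d n" and ?o = "\<lambda>i\<in>{..<d}. 0 :: int"
    interpret ferromagnet "nn_coupling d n \<beta>" K
      unfolding K_def by (rule ferromagnet_nn_coupling[OF assms])
    define B where "B u = {v \<in> lattice_box d (n + 1) - ?\<Lambda>. nearest_neighbor d u v}" for u
    define h where "h u = complex_of_real (\<beta> * real (card (B u)))" for u
    \<comment> \<open>Moving to a neighbor leads from one box at most to the next larger one; the level k = 0 must contain all points.\<close>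
    define A where "A k = (if k = 0 then UNIV else if k \<le> n then lattice_box d (n - k) else {})" for k
    have o: "?o \<in> lattice_box d m" for m by (auto simp: lattice_box_def)
    have "cmod (spin_mean ?\<Lambda> h ?o) \<le> 14 * (16 * K) ^ n"
    proof (rule spin_mean_decay[where A = A])
      show "A 0 = UNIV" by (simp add: A_def)
      show "u \<in> A k" if "v \<in> A (Suc k)" "nn_coupling d n \<beta> v u \<noteq> 0" for k v u
      proof (cases "k = 0")
        case False
        have k: "Suc k \<le> n" "v \<in> lattice_box d (n - Suc k)"
          using that(1) by (auto simp: A_def split: if_splits)
        have "nearest_neighbor d v u" "u \<in> ?\<Lambda>"
          using that(2) by (auto simp: nn_coupling_def split: if_splits)
        then have "u \<in> lattice_box d (Suc (n - Suc k))" by (rule neighbor_in_next_box[OF k(2)])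
        then show ?thesis using k False by (simp add: A_def Suc_diff_Suc)
      qed (simp add: A_def)
      show "strip h" by (simp add: strip_def h_def)
      show "cmod (h u) \<le> K" for u
      proof -
        have "card (B u) \<le> card {v \<in> lattice_box d (n + 1). nearest_neighbor d u v}"
          unfolding B_def by (intro card_mono) (auto simp: finite_lattice_box)
        also have "\<dots> \<le> 3 ^ d" by (rule card_neighbors_le)
        finally have "real (card (B u)) \<le> 3 ^ d" using of_nat_mono by fastforce
        then have "\<beta> * real (card (B u)) \<le> \<beta> * 3 ^ d" using assms(1) by (rule mult_left_mono)
        then show ?thesis using assms(1) by (simp add: h_def K_def norm_mult mult.commute)
      qed
      show "h u = 0" if "u \<in> A (Suc k)" for k u
      proof -
        have k: "Suc k \<le> n" "u \<in> lattice_box d (n - Suc k)"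
          using that by (auto simp: A_def split: if_splits)
        have "v \<in> ?\<Lambda>" if "v \<in> lattice_box d (n + 1)" "nearest_neighbor d u v" for v
        proof -
          have "Suc (n - Suc k) \<le> n" using k(1) by simp
          then show ?thesis
            using neighbor_in_next_box[OF k(2) that(2,1)] lattice_box_mono by blast
        qed
        then have "B u = {}" by (auto simp: B_def)
        then show ?thesis by (simp add: h_def)
      qed
      show "?o \<in> A n" using o by (simp add: A_def)
    qed (use o in \<open>auto simp: finite_lattice_box\<close>)
    moreover have "spin_mean ?\<Lambda> h ?o = of_real (LINT \<sigma>|ising_plus d n \<beta>. \<sigma> ?o)"
    proof -
      have w: "weight (nn_coupling d n \<beta>) ?\<Lambda> h \<sigma> = of_real (exp (\<beta> * (interaction d n \<sigma> +
        (\<Sum>u\<in>?\<Lambda>. \<Sum>v\<in>{v \<in> lattice_box d (n + 1) - ?\<Lambda>. nearest_neighbor d u v}. \<sigma> u))))" for \<sigma>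
        by (simp add: weight_def pair_energy_nn_coupling h_def B_def distrib_left sum_distrib_left
            mult.assoc flip: exp_of_real)
      show ?thesis
        unfolding spin_mean_def partition_function_def w ising_plus_def integral_gibbs_measure[OF finite_lattice_box]
        by simp
    qed
    ultimately show ?thesis by simp
  qed
  have "(\<lambda>n. (16 * K) ^ n) \<longlonglongrightarrow> 0"
    using K by (intro LIMSEQ_power_zero) simp
  then have lim: "(\<lambda>n. 14 * (16 * K) ^ n) \<longlonglongrightarrow> 0"
    by (rule tendsto_mult_right_zero)
  have "\<forall>\<^sub>F n in sequentially. norm (LINT \<sigma>|ising_plus d n \<beta>. \<sigma> (\<lambda>i\<in>{..<d}. 0)) \<le> 14 * (16 * K) ^ n"
    unfolding real_norm_def by (intro always_eventually allI bound)
  then have "(\<lambda>n. LINT \<sigma>|ising_plus d n \<beta>. \<sigma> (\<lambda>i\<in>{..<d}. 0)) \<longlonglongrightarrow> 0"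
    using lim by (rule Lim_null_comparison)
  then show ?thesis unfolding spontaneous_magnetization_def by (rule limI)
qed


section \<open>The limit law\<close>

text \<open>
  Both claims follow from the substitution \<open>y = a * x\<close>.
\<close>

lemma quartic_density_integral:
  fixes a :: real
  assumes "a > 0"
  defines "f \<equiv> \<lambda>x :: real. a * exp (- (a ^ 4 * x ^ 4)) / (\<integral>t. exp (- (t ^ 4)) \<partial>lborel)"
  shows "real_distribution (density lborel (\<lambda>x. ennreal (f x)))"
    and "char (density lborel (\<lambda>x. ennreal (f x))) \<theta> =
      (\<integral>y. exp (- (y ^ 4)) *\<^sub>R iexp (\<theta> * (y / a)) \<partial>lborel) / of_real (Gamma (1 / 4) / 2)"
proof -
  have J_int: "integrable lborel (\<lambda>x :: real. exp (- (x ^ 4)))"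
    and J: "(\<integral>x. exp (- (x ^ 4)) \<partial>lborel) = Gamma (1 / 4 :: real) / 2"
    using quartic_moment[of 0] by (simp_all add: has_bochner_integral_iff)
  have J_pos: "Gamma (1 / 4 :: real) / 2 > 0" using Gamma_real_pos[of "1 / 4"] by simp
  have f: "f x = exp (- ((a * x) ^ 4)) * (a / (Gamma (1 / 4) / 2))" for x
    by (simp add: f_def J power_mult_distrib)
  have f_nonneg: "f x \<ge> 0" for x using J_pos assms(1) unfolding f by (intro mult_nonneg_nonneg divide_nonneg_pos) auto
  have f_meas [measurable]: "f \<in> borel_measurable borel" unfolding f[abs_def] by measurable
  have scaled: "integrable lborel (\<lambda>x. exp (- ((0 + a * x) ^ 4)))"
    using assms(1) by (intro lborel_integrable_real_affine[OF J_int]) simp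
  then have f_int: "integrable lborel f" unfolding f[abs_def] by simp
  have "(\<integral>x. f x \<partial>lborel) = (\<integral>x. exp (- ((0 + a * x) ^ 4)) \<partial>lborel) * (a / (Gamma (1 / 4) / 2))"
    unfolding f by simp
  moreover have "Gamma (1 / 4) / 2 = a * (\<integral>x. exp (- ((0 + a * x) ^ 4)) \<partial>lborel)"
    using lborel_integral_real_affine[of a "\<lambda>x. exp (- (x ^ 4))" 0] assms(1) unfolding J by simp
  ultimately have "(\<integral>x. f x \<partial>lborel) = 1" using J_pos by (auto simp: zero_less_mult_iff)
  then have "prob_space (density lborel (\<lambda>x. ennreal (f x)))"
    using f_int f_nonneg by (intro prob_spaceI) (simp add: emeasure_density nn_integral_eq_integral)
  then show "real_distribution (density lborel (\<lambda>x. ennreal (f x)))"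
    by (simp add: real_distribution_def real_distribution_axioms_def)
  have "char (density lborel (\<lambda>x. ennreal (f x))) \<theta> = (\<integral>x. f x *\<^sub>R iexp (\<theta> * x) \<partial>lborel)"
    unfolding char_def using f_nonneg by (intro integral_density) auto
  also have "\<dots> = (1 / a) *\<^sub>R (\<integral>y. f (0 + 1 / a * y) *\<^sub>R iexp (\<theta> * (0 + 1 / a * y)) \<partial>lborel)"
    using assms(1) by (subst lborel_integral_real_affine[where c = "1 / a" and t = 0]) simp_all
  also have "(\<lambda>y. f (0 + 1 / a * y) *\<^sub>R iexp (\<theta> * (0 + 1 / a * y))) =
      (\<lambda>y. (a / (Gamma (1 / 4) / 2)) *\<^sub>R (exp (- (y ^ 4)) *\<^sub>R iexp (\<theta> * (y / a))))"
    using assms(1) by (intro ext) (simp add: f mult.commute)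
  also have "(1 / a) *\<^sub>R (\<integral>y. (a / (Gamma (1 / 4) / 2)) *\<^sub>R (exp (- (y ^ 4)) *\<^sub>R iexp (\<theta> * (y / a))) \<partial>lborel) =
      (\<integral>y. exp (- (y ^ 4)) *\<^sub>R iexp (\<theta> * (y / a)) \<partial>lborel) / of_real (Gamma (1 / 4) / 2)"
    using assms(1) unfolding integral_scaleR_right by (simp add: scaleR_conv_of_real)
  finally show "char (density lborel (\<lambda>x. ennreal (f x))) \<theta> =
      (\<integral>y. exp (- (y ^ 4)) *\<^sub>R iexp (\<theta> * (y / a)) \<partial>lborel) / of_real (Gamma (1 / 4) / 2)" .
qed

text \<open>
  The law of \<open>X\<^sub>n\<close> is the law of the magnetization under the weights tilted by \<open>exp (Y\<^sup>2 / (2 * \<langle>Y\<^sup>2\<rangle>))\<close>, so the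
  magnetizations of the free model form a \<open>quartic_family\<close> whose tilted variables are the \<open>X\<^sub>n\<close>. The assumption
  \<open>d \<ge> 1\<close> ensures that the number of sites tends to infinity.
\<close>

lemma perturbed_ising_quartic_limit:
  assumes "d \<ge> 1" "0 \<le> \<beta>" "8000 * (3 ^ d * \<beta>) \<le> 1"
  defines "C \<equiv> sqrt (Gamma (3 / 4) / Gamma (1 / 4))"
  shows "weak_conv_m
     (\<lambda>n. distr (X_law d n \<beta>) borel (\<lambda>x. x / sqrt (LINT y|X_law d n \<beta>. y\<^sup>2)))
     (density lborel
        (\<lambda>x. ennreal (C * exp (- (C ^ 4 * x ^ 4)) / (LINT t|lborel. exp (- (t ^ 4))))))"
proof -
  define \<Omega> where "\<Omega> n = spin_configs (lattice_box d n)" for n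
  define Zn where "Zn n = (\<Sum>\<sigma>\<in>\<Omega> n. exp (\<beta> * interaction d n \<sigma>))" for n
  define w where "w n \<sigma> = exp (\<beta> * interaction d n \<sigma>) / Zn n" for n \<sigma>
  define N where "N n = real (card (lattice_box d n))" for n
  define G where "G n x = ln (\<Sum>\<sigma>\<in>\<Omega> n. w n \<sigma> * exp (x * magnetization d n \<sigma>)) - Y_moment2 d n \<beta> * x\<^sup>2 / 2"
    for n x
  have Zn: "Zn n > 0" for n
    unfolding Zn_def \<Omega>_def by (rule partition_function_pos[OF finite_lattice_box])
  have "\<exists>\<kappa>. 1 / 32 \<le> \<kappa> \<and> \<kappa> \<le> 2 \<and> N n / 2 \<le> Y_moment2 d n \<beta> \<and>
     (\<forall>x. \<bar>x\<bar> \<le> 1 / 4 \<longrightarrow> \<bar>G n x + N n * \<kappa> * x ^ 4\<bar> \<le> 64 * N n * \<bar>x\<bar> ^ 6) \<and>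
     (\<forall>x. G n x \<le> - (N n / 24 * (x ^ 4 / (1 + x\<^sup>2))))" for n
  proof -
    interpret ferromagnet "nn_coupling d n \<beta>" "3 ^ d * \<beta>"
      by (rule ferromagnet_nn_coupling[OF assms(2,3)])
    have ne: "lattice_box d n \<noteq> {}"
      using card_lattice_box[of d n] by force
    show ?thesis
    proof (rule log_laplace_quartic[OF finite_lattice_box ne])
      show "exp (\<beta> * interaction d n \<sigma>) = exp (pair_energy (nn_coupling d n \<beta>) (lattice_box d n) \<sigma>)" for \<sigma>
        by (simp only: pair_energy_nn_coupling)
      show "magnetization d n \<sigma> = (\<Sum>v\<in>lattice_box d n. \<sigma> v)" for \<sigma>
        by (rule magnetization_def)
      show "N n = real (card (lattice_box d n))" by (rule N_def)
      show "Zn n = (\<Sum>\<sigma>\<in>spin_configs (lattice_box d n). exp (\<beta> * interaction d n \<sigma>))"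
        by (simp only: Zn_def \<Omega>_def)
      show "Y_moment2 d n \<beta> =
        (\<Sum>\<sigma>\<in>spin_configs (lattice_box d n). exp (\<beta> * interaction d n \<sigma>) * (magnetization d n \<sigma>)\<^sup>2) / Zn n"
        by (simp only: Y_moment2_def ising_free_def integral_gibbs_measure[OF finite_lattice_box] \<Omega>_def Zn_def)
      show "G n x = ln ((\<Sum>\<sigma>\<in>spin_configs (lattice_box d n). exp (\<beta> * interaction d n \<sigma>) * exp (x * magnetization d n \<sigma>)) / Zn n)
          - Y_moment2 d n \<beta> * x\<^sup>2 / 2" for x
        by (simp add: G_def w_def \<Omega>_def sum_divide_distrib)
    qed
  qed
  then obtain \<kappa> where \<kappa>: "\<And>n. 1 / 32 \<le> \<kappa> n" "\<And>n. \<kappa> n \<le> 2" "\<And>n. N n / 2 \<le> Y_moment2 d n \<beta>"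
     "\<And>n x. \<bar>x\<bar> \<le> 1 / 4 \<Longrightarrow> \<bar>G n x + N n * \<kappa> n * x ^ 4\<bar> \<le> 64 * N n * \<bar>x\<bar> ^ 6"
     "\<And>n x. G n x \<le> - (N n / 24 * (x ^ 4 / (1 + x\<^sup>2)))"
    by metis
  have N_ge: "real n \<le> N n" "1 \<le> N n" for n
  proof -
    have "(2 * n + 1) ^ 1 \<le> (2 * n + 1) ^ d" using assms(1) by (intro power_increasing) auto
    then have "n \<le> (2 * n + 1) ^ d" "1 \<le> (2 * n + 1) ^ d" by simp_all
    then show "real n \<le> N n" "1 \<le> N n"
      unfolding N_def card_lattice_box using of_nat_mono[of 1] by (fastforce intro: of_nat_mono)+
  qed
  interpret quartic_family \<Omega> w "magnetization d" N \<kappa> "\<lambda>n. Y_moment2 d n \<beta>" G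
  proof
    show "filterlim N at_top sequentially"
      by (rule filterlim_at_top_mono[OF filterlim_real_sequentially]) (simp add: N_ge)
  qed (use \<kappa> N_ge Zn in \<open>auto simp: \<Omega>_def finite_spin_configs finite_lattice_box spin_configs_nonempty w_def G_def\<close>)
  define M where "M n = perturbed_ising d n \<beta>" for n
  have M_meas: "f \<in> borel_measurable (M n)" for f :: "((nat \<Rightarrow> int) \<Rightarrow> real) \<Rightarrow> 'b :: topological_space" and n
    by (simp add: M_def perturbed_ising_def gibbs_measure_def point_measure_def)
  have M_prob: "prob_space (M n)" for n
    unfolding M_def perturbed_ising_def by (rule prob_space_gibbs_measure[OF finite_lattice_box])
  have X: "X_law d n \<beta> = distr (M n) borel (magnetization d n)" for n
    by (simp add: X_law_eq_perturbed M_def)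
  have tilt: "exp (\<beta> * interaction d n \<sigma> + (magnetization d n \<sigma>)\<^sup>2 / (2 * Y_moment2 d n \<beta>)) = Zn n * tilt n \<sigma>" for n \<sigma>
    using Zn[of n] by (simp add: tilt_def w_def exp_add)
  have second: "(LINT y|X_law d n \<beta>. y\<^sup>2) = second_moment n" for n
  proof -
    have "(LINT y|X_law d n \<beta>. y\<^sup>2) = (LINT \<sigma>|M n. (magnetization d n \<sigma>)\<^sup>2)"
      unfolding X by (intro integral_distr M_meas) simp
    also have "\<dots> = second_moment n"
      unfolding M_def perturbed_ising_def integral_gibbs_measure[OF finite_lattice_box] tilt
      using Zn[of n] by (simp add: second_moment_def \<Omega>_def mult.assoc flip: sum_distrib_left)
    finally show ?thesis .
  qed
  define c where "c n = sqrt (second_moment n)" for n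
  have law: "distr (X_law d n \<beta>) borel (\<lambda>x. x / sqrt (LINT y|X_law d n \<beta>. y\<^sup>2)) =
      distr (M n) borel (\<lambda>\<sigma>. magnetization d n \<sigma> / c n)" for n
    unfolding second c_def[symmetric] unfolding X
    by (subst distr_distr) (auto simp: M_meas o_def)
  have char: "char (distr (M n) borel (\<lambda>\<sigma>. magnetization d n \<sigma> / c n)) \<theta> =
      (\<Sum>\<sigma>\<in>\<Omega> n. of_real (tilt n \<sigma>) * iexp (\<theta> * (magnetization d n \<sigma> / c n))) / of_real (\<Sum>\<sigma>\<in>\<Omega> n. tilt n \<sigma>)"
    for n \<theta>
  proof -
    have "char (distr (M n) borel (\<lambda>\<sigma>. magnetization d n \<sigma> / c n)) \<theta> =
        (LINT \<sigma>|M n. iexp (\<theta> * (magnetization d n \<sigma> / c n)))"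
      unfolding char_def by (intro integral_distr M_meas) measurable
    also have "\<dots> = (\<Sum>\<sigma>\<in>\<Omega> n. of_real (tilt n \<sigma>) * iexp (\<theta> * (magnetization d n \<sigma> / c n))) / of_real (\<Sum>\<sigma>\<in>\<Omega> n. tilt n \<sigma>)"
      unfolding M_def perturbed_ising_def integral_gibbs_measure_complex[OF finite_lattice_box] tilt
      using Zn[of n] by (simp add: \<Omega>_def mult.assoc flip: sum_distrib_left)
    finally show ?thesis .
  qed
  have C: "C = quartic_scale" "C > 0" using quartic_scale_pos by (simp_all add: C_def quartic_scale_def)
  show ?thesis
    unfolding law
  proof (rule levy_continuity)
    show "real_distribution (distr (M n) borel (\<lambda>\<sigma>. magnetization d n \<sigma> / c n))" for n
      by (rule prob_space.real_distribution_distr[OF M_prob M_meas])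
    show "real_distribution (density lborel
        (\<lambda>x. ennreal (C * exp (- (C ^ 4 * x ^ 4)) / (LINT t|lborel. exp (- (t ^ 4))))))"
      by (rule quartic_density_integral(1)[OF C(2)])
    show "(\<lambda>n. char (distr (M n) borel (\<lambda>\<sigma>. magnetization d n \<sigma> / c n)) \<theta>) \<longlonglongrightarrow>
      char (density lborel (\<lambda>x. ennreal (C * exp (- (C ^ 4 * x ^ 4)) / (LINT t|lborel. exp (- (t ^ 4)))))) \<theta>" for \<theta>
      unfolding char quartic_density_integral(2)[OF C(2)] unfolding c_def C(1) by (rule char_tendsto)
  qed
qed

theorem corollary1:
  fixes d :: nat
  assumes "d \<ge> 1"
  shows "\<exists>\<beta>\<^sub>1 :: ereal. 0 < \<beta>\<^sub>1 \<and> \<beta>\<^sub>1 \<le> beta_c d \<and>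
    (\<forall>\<beta> :: real. 0 \<le> \<beta> \<longrightarrow> ereal \<beta> < \<beta>\<^sub>1 \<longrightarrow>
      (let C = sqrt (Gamma (3 / 4) / Gamma (1 / 4)) in
        weak_conv_m
          (\<lambda>n. distr (X_law d n \<beta>) borel (\<lambda>x. x / sqrt (LINT y|X_law d n \<beta>. y\<^sup>2)))
          (density lborel
            (\<lambda>x. ennreal (C * exp (- (C ^ 4 * x ^ 4)) / (LINT t|lborel. exp (- (t ^ 4))))))))"
proof -
  define \<beta>\<^sub>1 :: real where "\<beta>\<^sub>1 = 1 / (8000 * 3 ^ d)"
  have small: "8000 * (3 ^ d * \<beta>) \<le> 1" if "\<beta> < \<beta>\<^sub>1" for \<beta>
    using that by (simp add: \<beta>\<^sub>1_def field_simps)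
  have "ereal \<beta>\<^sub>1 \<le> beta_c d"
    unfolding beta_c_def
  proof (rule INF_greatest)
    \<comment> \<open>Below this value there is no spontaneous magnetization, hence it is a lower bound for the critical one.\<close>
    fix \<beta> assume "\<beta> \<in> {\<beta>. 0 \<le> \<beta> \<and> spontaneous_magnetization d \<beta> > 0}"
    then show "ereal \<beta>\<^sub>1 \<le> ereal \<beta>"
      using spontaneous_magnetization_zero[of \<beta> d] small[of \<beta>] by force
  qed
  moreover have "0 < ereal \<beta>\<^sub>1" by (simp add: \<beta>\<^sub>1_def)
  ultimately show ?thesis
    using perturbed_ising_quartic_limit[OF assms] small
    by (intro exI[of _ "ereal \<beta>\<^sub>1"]) (simp add: Let_def)
qed

end
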